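(* Let $\mathrm{M}$ be an o-minimal structure expanding $(\mathbb{R},<,+,\cdot)$ and let $\mathrm{Def}(\mathrm{M})$ be the category of definable sets and definable maps. For all objects $I$, $O$ of $\mathrm{Def}(\mathrm{M})$, the category $\mathrm{Sys}_{\mathrm{ho}}(I,O)$ of homogeneous Mealy machines over $\mathrm{Def}(\mathrm{M})$ with fixed input object $I$ and fixed output object $O$ is adhesive.
   Context: An o-minimal structure $\mathrm{M}$ expanding $(\mathbb{R},<,+,\cdot)$ is a sequence $(\mathcal{D}_n)_{n\ge 1}$ of Boolean algebras of subsets of $\mathbb{R}^n$, closed under products and projections, such that $\mathcal{D}_n$ contains all semialgebraic sets and $\mathcal{D}_1$ consists exactly of finite unions of intervals and points. Elements of $\mathcal{D}_n$ are the definable sets; a function between definable sets is definable if its graph is definable (definable maps need not be continuous). $\mathrm{Def}(\mathrm{M})$ is the category of definable sets and definable maps. A homogeneous Mealy machine with interface $(I,O)$ is an object $S$ together with a morphism $\alpha : S\times I\to S\times O$. The category $\mathrm{Sys}_{\mathrm{ho}}(I,O)$ has these as objects; a morphism $(S,\alpha)\to(S',\alpha')$ is a morphism $f:S\to S'$ (used for both before-states and after-states, with identity components on $I$ and $O$) such that $(f\times \mathrm{id}_O)\circ\alpha=\alpha'\circ(f\times\mathrm{id}_I)$. Standing convention: $I$ and $O$ are non-empty. A category is adhesive (Lack–Sobociński) if it has pullbacks, has pushouts along monomorphisms, and pushouts along monomorphisms are Van Kampen squares: for every commutative cube whose bottom face is such a pushout and whose back and left faces are pullbacks, the top face is a pushout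 if and only if the front and right faces are pullbacks. *)

theory Defs
  imports "HOL-Analysis.Analysis" "HOL-Library.FuncSet"
begin

section \<open>Categories and adhesivity\<close>

record ('o, 'm) cat =
  Obj :: "'o set"
  Arr :: "'m set"
  Dom :: "'m \<Rightarrow> 'o"
  Cod :: "'m \<Rightarrow> 'o"
  Ide :: "'o \<Rightarrow> 'm"
  Cmp :: "'m \<Rightarrow> 'm \<Rightarrow> 'm"  (infixr \<open>\<cdot>\<index>\<close> 70)

definition Hom :: "('o, 'm, 'z) cat_scheme \<Rightarrow> 'o \<Rightarrow> 'o \<Rightarrow> 'm set" where
  "Hom C A B = {f \<in> Arr C. Dom C f = A \<and> Cod C f = B}"

locale category =
  fixes C :: "('o, 'm, 'z) cat_scheme" (structure)
  assumes Dom_Obj: "f \<in> Arr C \<Longrightarrow> Dom C f \<in> Obj C"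
    and Cod_Obj: "f \<in> Arr C \<Longrightarrow> Cod C f \<in> Obj C"
    and Ide_Hom: "A \<in> Obj C \<Longrightarrow> Ide C A \<in> Hom C A A"
    and Cmp_Hom: "f \<in> Hom C X Y \<Longrightarrow> g \<in> Hom C Y Z \<Longrightarrow> g \<cdot> f \<in> Hom C X Z"
    and Cmp_Ide: "f \<in> Hom C X Y \<Longrightarrow> f \<cdot> Ide C X = f"
    and Ide_Cmp: "f \<in> Hom C X Y \<Longrightarrow> Ide C Y \<cdot> f = f"
    and Cmp_assoc: "f \<in> Hom C W X \<Longrightarrow> g \<in> Hom C X Y \<Longrightarrow> h \<in> Hom C Y Z \<Longrightarrow>
      (h \<cdot> g) \<cdot> f = h \<cdot> (g \<cdot> f)"

definition mono_arr :: "('o, 'm, 'z) cat_scheme \<Rightarrow> 'm \<Rightarrow> bool" where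
  "mono_arr C m \<longleftrightarrow> m \<in> Arr C \<and>
     (\<forall>X. \<forall>g \<in> Hom C X (Dom C m). \<forall>h \<in> Hom C X (Dom C m).
        m \<cdot>\<^bsub>C\<^esub> g = m \<cdot>\<^bsub>C\<^esub> h \<longrightarrow> g = h)"

text \<open>
  The arguments of a square are listed as \<open>f g p q\<close>, where \<open>f : W \<rightarrow> X\<close> and \<open>g : W \<rightarrow> Y\<close>
  leave the common source and \<open>p : X \<rightarrow> Z\<close> and \<open>q : Y \<rightarrow> Z\<close> enter the common target.
\<close>

definition commutes :: "('o, 'm, 'z) cat_scheme \<Rightarrow> 'm \<Rightarrow> 'm \<Rightarrow> 'm \<Rightarrow> 'm \<Rightarrow> bool" where
  "commutes C f g p q \<longleftrightarrow>
     (\<exists>W X Y Z. f \<in> Hom C W X \<and> g \<in> Hom C W Y \<and> p \<in> Hom C X Z \<and> q \<in> Hom C Y Z) \<and>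
     p \<cdot>\<^bsub>C\<^esub> f = q \<cdot>\<^bsub>C\<^esub> g"

definition pullback :: "('o, 'm, 'z) cat_scheme \<Rightarrow> 'm \<Rightarrow> 'm \<Rightarrow> 'm \<Rightarrow> 'm \<Rightarrow> bool" where
  "pullback C f g p q \<longleftrightarrow> commutes C f g p q \<and>
     (\<forall>f' g'. commutes C f' g' p q \<longrightarrow>
        (\<exists>!h. h \<in> Hom C (Dom C f') (Dom C f) \<and> f \<cdot>\<^bsub>C\<^esub> h = f' \<and> g \<cdot>\<^bsub>C\<^esub> h = g'))"

definition pushout :: "('o, 'm, 'z) cat_scheme \<Rightarrow> 'm \<Rightarrow> 'm \<Rightarrow> 'm \<Rightarrow> 'm \<Rightarrow> bool" where
  "pushout C f g p q \<longleftrightarrow> commutes C f g p q \<and>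
     (\<forall>p' q'. commutes C f g p' q' \<longrightarrow>
        (\<exists>!h. h \<in> Hom C (Cod C p) (Cod C p') \<and> h \<cdot>\<^bsub>C\<^esub> p = p' \<and> h \<cdot>\<^bsub>C\<^esub> q = q'))"

definition has_pullbacks :: "('o, 'm, 'z) cat_scheme \<Rightarrow> bool" where
  "has_pullbacks C \<longleftrightarrow>
     (\<forall>X Y Z. \<forall>p \<in> Hom C X Z. \<forall>q \<in> Hom C Y Z. \<exists>f g. pullback C f g p q)"

definition has_pushouts_along_monos :: "('o, 'm, 'z) cat_scheme \<Rightarrow> bool" where
  "has_pushouts_along_monos C \<longleftrightarrow>
     (\<forall>W X Y. \<forall>m \<in> Hom C W X. \<forall>f \<in> Hom C W Y. mono_arr C m \<longrightarrow> (\<exists>p q. pushout C m f p q))"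

text \<open>
  The cube has bottom face \<open>m f g n\<close>, top face \<open>m' f' g' n'\<close> and vertical arrows
  \<open>w, x, y, z\<close> from the four corners of the top face to those of the bottom face.
  The back and left faces are the vertical faces over \<open>m\<close> and \<open>f\<close>; the front and right
  faces are those over \<open>g\<close> and \<open>n\<close>.
\<close>

definition van_kampen :: "('o, 'm, 'z) cat_scheme \<Rightarrow> 'm \<Rightarrow> 'm \<Rightarrow> 'm \<Rightarrow> 'm \<Rightarrow> bool" where
  "van_kampen C m f g n \<longleftrightarrow>
     (\<forall>m' f' g' n' w x y z.
        commutes C m f g n \<and> commutes C m' f' g' n' \<and>
        commutes C m' w x m \<and> commutes C f' w y f \<and>
        commutes C g' x z g \<and> commutes C n' y z n \<and>
        pullback C m' w x m \<and> pullback C f' w y f \<longrightarrow>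
        (pushout C m' f' g' n' \<longleftrightarrow> pullback C g' x z g \<and> pullback C n' y z n))"

definition adhesive :: "('o, 'm, 'z) cat_scheme \<Rightarrow> bool" where
  "adhesive C \<longleftrightarrow> category C \<and> has_pullbacks C \<and> has_pushouts_along_monos C \<and>
     (\<forall>m f g n. mono_arr C m \<and> pushout C m f g n \<longrightarrow> van_kampen C m f g n)"


section \<open>O-minimal structures\<close>

text \<open>Points of \<open>\<real>\<^sup>n\<close> are the real lists of length \<open>n\<close>, so that the product of
  \<open>A \<subseteq> \<real>\<^sup>m\<close> and \<open>B \<subseteq> \<real>\<^sup>n\<close> is literally a subset of \<open>\<real>\<^sup>m\<^sup>+\<^sup>n\<close>.\<close>

definition Rn :: "nat \<Rightarrow> real list set" where
  "Rn n = {xs. length xs = n}"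

definition cprod :: "real list set \<Rightarrow> real list set \<Rightarrow> real list set" where
  "cprod A B = {xs @ ys | xs ys. xs \<in> A \<and> ys \<in> B}"

inductive poly_fun :: "nat \<Rightarrow> (real list \<Rightarrow> real) \<Rightarrow> bool" for n where
  const: "poly_fun n (\<lambda>xs. c)"
| coord: "i < n \<Longrightarrow> poly_fun n (\<lambda>xs. xs ! i)"
| add: "poly_fun n p \<Longrightarrow> poly_fun n q \<Longrightarrow> poly_fun n (\<lambda>xs. p xs + q xs)"
| mult: "poly_fun n p \<Longrightarrow> poly_fun n q \<Longrightarrow> poly_fun n (\<lambda>xs. p xs * q xs)"

inductive_set semialgebraic :: "nat \<Rightarrow> real list set set" for n where
  eq: "poly_fun n p \<Longrightarrow> {xs \<in> Rn n. p xs = 0} \<in> semialgebraic n"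
| pos: "poly_fun n p \<Longrightarrow> {xs \<in> Rn n. p xs > 0} \<in> semialgebraic n"
| union: "A \<in> semialgebraic n \<Longrightarrow> B \<in> semialgebraic n \<Longrightarrow> A \<union> B \<in> semialgebraic n"
| inter: "A \<in> semialgebraic n \<Longrightarrow> B \<in> semialgebraic n \<Longrightarrow> A \<inter> B \<in> semialgebraic n"
| compl: "A \<in> semialgebraic n \<Longrightarrow> Rn n - A \<in> semialgebraic n"

text \<open>The structure is indexed by \<open>n \<ge> 1\<close>; the value \<open>D 0\<close> is junk and is never used.\<close>

locale o_minimal =
  fixes D :: "nat \<Rightarrow> real list set set"
  assumes boolean_algebra: "n \<ge> 1 \<Longrightarrow> algebra (Rn n) (D n)"
    and product: "m \<ge> 1 \<Longrightarrow> n \<ge> 1 \<Longrightarrow> A \<in> D m \<Longrightarrow> B \<in> D n \<Longrightarrow> cprod A B \<in> D (m + n)"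
    and projection: "n \<ge> 1 \<Longrightarrow> A \<in> D (Suc n) \<Longrightarrow> take n ` A \<in> D n"
    and semialgebraic: "n \<ge> 1 \<Longrightarrow> semialgebraic n \<subseteq> D n"
    and one_dim: "D 1 = {(\<lambda>x. [x]) ` \<Union>F | F :: real set set.
      finite F \<and> (\<forall>X \<in> F. is_interval X \<or> (\<exists>a. X = {a}))}"

definition definable :: "(nat \<Rightarrow> real list set set) \<Rightarrow> real list set \<Rightarrow> bool" where
  "definable D A \<longleftrightarrow> (\<exists>n \<ge> 1. A \<in> D n)"


section \<open>The category of definable sets\<close>

type_synonym def_arr = "real list set \<times> (real list \<Rightarrow> real list) \<times> real list set"

text \<open>A map \<open>A \<rightarrow> B\<close> is represented by its source, its target and a function that is
  \<^const>\<open>undefined\<close> outside \<open>A\<close>, so that equal maps are represented by equal triples.\<close>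

definition definable_map :: "(nat \<Rightarrow> real list set set) \<Rightarrow> def_arr \<Rightarrow> bool" where
  "definable_map D = (\<lambda>(A, f, B).
     definable D A \<and> definable D B \<and> f \<in> A \<rightarrow>\<^sub>E B \<and> definable D {xs @ f xs | xs. xs \<in> A})"

text \<open>The chosen products \<open>X \<times> Y\<close> and \<open>f \<times> g\<close> are carried along as data; below they are
  instantiated with the cartesian product of definable sets and maps.\<close>

record ('o, 'm) prod_cat = "('o, 'm) cat" +
  ProdObj :: "'o \<Rightarrow> 'o \<Rightarrow> 'o"
  ProdArr :: "'m \<Rightarrow> 'm \<Rightarrow> 'm"

text \<open>All points of a definable set have the same length, so a point of \<open>cprod A A'\<close> splits
  uniquely as \<open>xs @ ys\<close> with \<open>xs \<in> A\<close> and \<open>ys \<in> A'\<close>.\<close>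

definition DefCat ::
  "(nat \<Rightarrow> real list set set) \<Rightarrow> (real list set, def_arr) prod_cat" where
  "DefCat D = \<lparr>
     Obj = {A. definable D A},
     Arr = {f. definable_map D f},
     Dom = (\<lambda>(A, f, B). A),
     Cod = (\<lambda>(A, f, B). B),
     Ide = (\<lambda>A. (A, \<lambda>xs \<in> A. xs, A)),
     Cmp = (\<lambda>(B', g, C) (A, f, B). (A, compose A g f, C)),
     ProdObj = cprod,
     ProdArr = (\<lambda>(A, f, B) (A', f', B').
       (cprod A A',
        \<lambda>z \<in> cprod A A'. THE w. \<exists>xs \<in> A. \<exists>ys \<in> A'. z = xs @ ys \<and> w = f xs @ f' ys,
        cprod B B'))\<rparr>"


section \<open>Homogeneous Mealy machines\<close>

definition mealy_ho :: "('o, 'm, 'z) prod_cat_scheme \<Rightarrow> 'o \<Rightarrow> 'o \<Rightarrow> ('o \<times> 'm) set" where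
  "mealy_ho C I J =
     {(S, \<alpha>). S \<in> Obj C \<and> \<alpha> \<in> Hom C (ProdObj C S I) (ProdObj C S J)}"

definition SysHo :: "('o, 'm, 'z) prod_cat_scheme \<Rightarrow> 'o \<Rightarrow> 'o \<Rightarrow>
    ('o \<times> 'm, ('o \<times> 'm) \<times> 'm \<times> ('o \<times> 'm)) cat" where
  "SysHo C I J = \<lparr>
     Obj = mealy_ho C I J,
     Arr = {((S, \<alpha>), f, (S', \<alpha>')) | S \<alpha> f S' \<alpha>'.
       (S, \<alpha>) \<in> mealy_ho C I J \<and> (S', \<alpha>') \<in> mealy_ho C I J \<and> f \<in> Hom C S S' \<and>
       ProdArr C f (Ide C J) \<cdot>\<^bsub>C\<^esub> \<alpha> = \<alpha>' \<cdot>\<^bsub>C\<^esub> ProdArr C f (Ide C I)},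
     Dom = (\<lambda>(M, f, M'). M),
     Cod = (\<lambda>(M, f, M'). M'),
     Ide = (\<lambda>(S, \<alpha>). ((S, \<alpha>), Ide C S, (S, \<alpha>))),
     Cmp = (\<lambda>(N, g, N') (M, f, M'). (M, g \<cdot>\<^bsub>C\<^esub> f, N'))\<rparr>"

end

theory Submission
  imports Defs
begin

text \<open>
  Everything is inherited from sets. Sending a machine to its set of states is a faithful functor, and it
  computes pullbacks and pushouts along monomorphisms as in sets, so that the Van Kampen condition becomes a
  statement about a cube of sets and functions, which is checked point by point
  (\<open>set_cube.van_kampen_sets\<close>).

  Pullbacks are computed on states because two states over a common state step to states over a common state,
  with equal outputs: the fibre product of the state spaces is closed under stepping in both components
  (\<open>pullback_exists_Sys\<close>). In particular the kernel pair of a morphism is the set-theoretic one, and therefore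
  monomorphisms are injective.

  For the pushout of a monomorphism \<open>m : W \<rightarrow> X\<close> along \<open>f : W \<rightarrow> Y\<close>, the point is that the image of \<open>m\<close> has a
  definable complement. The state space of the pushout is the disjoint union of \<open>Y\<close> and \<open>X - m ` W\<close>, and a
  step of \<open>X\<close> that enters the image of \<open>m\<close> continues in \<open>Y\<close> by way of \<open>f\<close> (\<open>gluing_exists_Sys\<close>).

  That these squares are universal, and that up to isomorphism they are the only pullbacks and pushouts along
  monomorphisms, is derived once and for all in the locale \<open>set_like_category\<close>. Besides the two constructions
  it requires that functions compatible with a jointly injective cone or a jointly surjective cocone are
  morphisms. For machines this holds because definable functions are closed under pairing, composition,
  inversion and images; these closure properties come down to products, projections and equations
  between coordinates (\<open>D_select_image\<close>).
\<close>

section \<open>Cubes of sets\<close>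

definition set_pullback ::
  "'a set \<Rightarrow> 'a set \<Rightarrow> 'a set \<Rightarrow> ('a \<Rightarrow> 'a) \<Rightarrow> ('a \<Rightarrow> 'a) \<Rightarrow> ('a \<Rightarrow> 'a) \<Rightarrow> ('a \<Rightarrow> 'a) \<Rightarrow> bool" where
  "set_pullback W X Y f g p q \<longleftrightarrow>
     (\<forall>x \<in> X. \<forall>y \<in> Y. p x = q y \<longrightarrow> (\<exists>!w. w \<in> W \<and> f w = x \<and> g w = y))"

text \<open>The pushout of an injection \<open>m : W \<rightarrow> X\<close> along \<open>f : W \<rightarrow> Y\<close> is the disjoint union of \<open>Y\<close> and
  \<open>X - m ` W\<close>. The predicate says that \<open>n\<close> and \<open>g\<close> exhibit \<open>Z\<close> in this way; the map \<open>f\<close> enters only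
  through the equation \<open>g \<circ> m = n \<circ> f\<close>, which is always stated separately.\<close>

definition set_gluing ::
  "'a set \<Rightarrow> 'a set \<Rightarrow> 'a set \<Rightarrow> 'a set \<Rightarrow> ('a \<Rightarrow> 'a) \<Rightarrow> ('a \<Rightarrow> 'a) \<Rightarrow> ('a \<Rightarrow> 'a) \<Rightarrow> bool" where
  "set_gluing W X Y Z m g n \<longleftrightarrow>
     inj_on n Y \<and> inj_on g (X - m ` W) \<and> g ` (X - m ` W) \<inter> n ` Y = {} \<and>
     Z \<subseteq> g ` (X - m ` W) \<union> n ` Y"

lemma set_pullbackE:
  assumes "set_pullback W X Y f g p q" "x \<in> X" "y \<in> Y" "p x = q y"
  obtains w where "w \<in> W" "f w = x" "g w = y"
  using assms unfolding set_pullback_def by blast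

lemma set_pullback_unique:
  assumes "set_pullback W X Y f g p q" "f \<in> W \<rightarrow> X" "g \<in> W \<rightarrow> Y"
    "\<And>w. w \<in> W \<Longrightarrow> p (f w) = q (g w)"
    "w \<in> W" "w' \<in> W" "f w = f w'" "g w = g w'"
  shows "w = w'"
proof -
  have "\<exists>!v. v \<in> W \<and> f v = f w \<and> g v = g w"
    using assms unfolding set_pullback_def by (simp add: Pi_iff)
  then show ?thesis using assms by metis
qed

text \<open>The hypotheses of the Van Kampen condition, with the bottom face written as a gluing and the back and
  left faces as fibre products of sets.\<close>

locale set_cube =
  fixes W X Y Z W' X' Y' Z' :: "'a set"
    and m f g n m' f' g' n' w x y z :: "'a \<Rightarrow> 'a"
  assumes maps: "m \<in> W \<rightarrow> X" "f \<in> W \<rightarrow> Y" "g \<in> X \<rightarrow> Z" "n \<in> Y \<rightarrow> Z"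
      "m' \<in> W' \<rightarrow> X'" "f' \<in> W' \<rightarrow> Y'" "g' \<in> X' \<rightarrow> Z'" "n' \<in> Y' \<rightarrow> Z'"
      "w \<in> W' \<rightarrow> W" "x \<in> X' \<rightarrow> X" "y \<in> Y' \<rightarrow> Y" "z \<in> Z' \<rightarrow> Z"
    and bottom_sq: "\<And>a. a \<in> W \<Longrightarrow> g (m a) = n (f a)"
    and top_sq: "\<And>a. a \<in> W' \<Longrightarrow> g' (m' a) = n' (f' a)"
    and back_sq: "\<And>a. a \<in> W' \<Longrightarrow> x (m' a) = m (w a)"
    and left_sq: "\<And>a. a \<in> W' \<Longrightarrow> y (f' a) = f (w a)"
    and front_sq: "\<And>a. a \<in> X' \<Longrightarrow> z (g' a) = g (x a)"
    and right_sq: "\<And>a. a \<in> Y' \<Longrightarrow> z (n' a) = n (y a)"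
    and inj_m: "inj_on m W"
    and back_pullback: "set_pullback W' X' W m' w x m"
    and left_pullback: "set_pullback W' Y' W f' w y f"
    and bottom_gluing: "set_gluing W X Y Z m g n"
begin

text \<open>Because the back face is a pullback, the vertical map \<open>x\<close> respects the decompositions
  \<open>X = m ` W \<union> (X - m ` W)\<close> and \<open>X' = m' ` W' \<union> (X' - m' ` W')\<close>. This is what
  relates the corresponding decompositions of \<open>Z\<close> and \<open>Z'\<close>.\<close>

lemma outside_image:
  assumes "a \<in> X'"
  shows "x a \<in> m ` W \<longleftrightarrow> a \<in> m' ` W'"
proof
  assume "x a \<in> m ` W"
  then obtain b where "b \<in> W" "x a = m b" by blast
  then obtain c where "c \<in> W'" "m' c = a"
    using set_pullbackE[OF back_pullback assms] by metis
  then show "a \<in> m' ` W'" by blast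
next
  assume "a \<in> m' ` W'"
  then show "x a \<in> m ` W" using back_sq maps by (auto simp: Pi_iff)
qed

lemma n_inj:
  assumes "a \<in> Y" "b \<in> Y" "n a = n b"
  shows "a = b"
proof -
  have "inj_on n Y" using bottom_gluing unfolding set_gluing_def by simp
  from inj_onD[OF this assms(3,1,2)] show ?thesis .
qed

lemma g_inj:
  assumes "c \<in> X" "c \<notin> m ` W" "d \<in> X" "d \<notin> m ` W" "g c = g d"
  shows "c = d"
proof -
  have "inj_on g (X - m ` W)" using bottom_gluing unfolding set_gluing_def by simp
  from inj_onD[OF this assms(5)] assms show ?thesis by simp
qed

lemma disj:
  assumes "c \<in> X" "a \<in> Y" "g c = n a"
  shows "c \<in> m ` W"
proof (rule ccontr)
  assume "c \<notin> m ` W"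
  then have "n a \<in> g ` (X - m ` W) \<inter> n ` Y" unfolding assms(3)[symmetric] using assms by force
  then show False using bottom_gluing unfolding set_gluing_def by simp
qed

lemma cover:
  assumes "e \<in> Z"
  shows "(\<exists>c \<in> X - m ` W. e = g c) \<or> (\<exists>a \<in> Y. e = n a)"
proof -
  have "Z \<subseteq> g ` (X - m ` W) \<union> n ` Y"
    using bottom_gluing unfolding set_gluing_def by simp
  then show ?thesis using assms by (simp add: subset_iff image_iff)
qed

text \<open>If the front and right faces are pullbacks, then a point of \<open>Z'\<close> is determined by its image in \<open>Z\<close> together
  with a point of \<open>X\<close> or \<open>Y\<close> above that image, so the decomposition of \<open>Z\<close> pulls back to one of \<open>Z'\<close>.\<close>

lemma top_gluing_if:
  assumes pf: "set_pullback X' Z' X g' x z g" and pr: "set_pullback Y' Z' Y n' y z n"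
  shows "set_gluing W' X' Y' Z' m' g' n'"
  unfolding set_gluing_def
proof (intro conjI)
  show "inj_on n' Y'"
  proof (rule inj_onI)
    fix a b assume ab: "a \<in> Y'" "b \<in> Y'" "n' a = n' b"
    then have eq: "y a = y b" using right_sq[of a] right_sq[of b] n_inj[of "y a" "y b"] maps by (auto simp: Pi_iff)
    show "a = b" by (rule set_pullback_unique[OF pr maps(8) maps(11) right_sq ab eq])
  qed
  show "inj_on g' (X' - m' ` W')"
  proof (rule inj_onI)
    fix a b assume ab: "a \<in> X' - m' ` W'" "b \<in> X' - m' ` W'" "g' a = g' b"
    then have "x a \<notin> m ` W" "x b \<notin> m ` W" using outside_image by auto
    moreover have "g (x a) = g (x b)" using ab front_sq[of a] front_sq[of b] by auto
    ultimately have eq: "x a = x b" using ab maps g_inj[of "x a" "x b"] by (auto simp: Pi_iff)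
    have X': "a \<in> X'" "b \<in> X'" using ab by auto
    show "a = b" by (rule set_pullback_unique[OF pf maps(7) maps(10) front_sq X' ab(3) eq])
  qed
  show "g' ` (X' - m' ` W') \<inter> n' ` Y' = {}"
  proof -
    have False if "a \<in> X'" "a \<notin> m' ` W'" "b \<in> Y'" "g' a = n' b" for a b
    proof -
      have "g (x a) = n (y b)" using that front_sq[of a] right_sq[of b] by simp
      then have "x a \<in> m ` W" using disj that maps by (auto simp: Pi_iff)
      then show False using outside_image that by simp
    qed
    then show ?thesis by blast
  qed
  show "Z' \<subseteq> g' ` (X' - m' ` W') \<union> n' ` Y'"
  proof
    fix c assume c: "c \<in> Z'"
    then have "z c \<in> Z" using maps by (simp add: Pi_iff)
    then consider a where "a \<in> X" "a \<notin> m ` W" "z c = g a" | b where "b \<in> Y" "z c = n b"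
      using cover by fastforce
    then show "c \<in> g' ` (X' - m' ` W') \<union> n' ` Y'"
    proof cases
      case 1
      obtain a' where "a' \<in> X'" "g' a' = c" "x a' = a"
        by (rule set_pullbackE[OF pf c 1(1,3)])
      then show ?thesis using outside_image[of a'] 1 by blast
    next
      case 2
      obtain b' where "b' \<in> Y'" "n' b' = c" by (rule set_pullbackE[OF pr c 2])
      then show ?thesis by blast
    qed
  qed
qed

context
  assumes top_gluing: "set_gluing W' X' Y' Z' m' g' n'"
begin

lemma n'_inj:
  assumes "a \<in> Y'" "b \<in> Y'" "n' a = n' b"
  shows "a = b"
proof -
  have "inj_on n' Y'" using top_gluing unfolding set_gluing_def by simp
  from inj_onD[OF this assms(3,1,2)] show ?thesis .
qed

lemma g'_inj:
  assumes "c \<in> X'" "c \<notin> m' ` W'" "d \<in> X'" "d \<notin> m' ` W'" "g' c = g' d"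
  shows "c = d"
proof -
  have "inj_on g' (X' - m' ` W')" using top_gluing unfolding set_gluing_def by simp
  from inj_onD[OF this assms(5)] assms show ?thesis by simp
qed

lemma cover':
  assumes "e \<in> Z'"
  shows "(\<exists>c \<in> X' - m' ` W'. e = g' c) \<or> (\<exists>a \<in> Y'. e = n' a)"
proof -
  have "Z' \<subseteq> g' ` (X' - m' ` W') \<union> n' ` Y'"
    using top_gluing unfolding set_gluing_def by simp
  then show ?thesis using assms by (simp add: subset_iff image_iff)
qed

text \<open>A point of \<open>Z'\<close> over \<open>n ` Y\<close> cannot come from \<open>X' - m' ` W'\<close>, since \<open>x\<close> maps that set to
  \<open>X - m ` W\<close>, and the image of the latter under \<open>g\<close> is disjoint from \<open>n ` Y\<close>. So it comes from \<open>Y'\<close>, and from one point only as \<open>n'\<close> is injective.\<close>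

lemma right_pullback: "set_pullback Y' Z' Y n' y z n"
  unfolding set_pullback_def
proof (intro ballI impI)
  fix e b assume e: "e \<in> Z'" and b: "b \<in> Y" and eb: "z e = n b"
  have "\<exists>a \<in> Y'. e = n' a"
  proof (rule ccontr)
    assume "\<not> ?thesis"
    then obtain c where c: "c \<in> X'" "c \<notin> m' ` W'" "e = g' c" using cover'[OF e] by blast
    then have "g (x c) = n b" using front_sq eb by simp
    then have "x c \<in> m ` W" using disj b c maps by (auto simp: Pi_iff)
    then show False using outside_image c by simp
  qed
  then obtain a where a: "a \<in> Y'" "e = n' a" by blast
  then have "y a = b" using n_inj[of "y a" b] right_sq[of a] eb b maps by (auto simp: Pi_iff)
  then show "\<exists>!a. a \<in> Y' \<and> n' a = e \<and> y a = b" using a n'_inj by metis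
qed

text \<open>Here both kinds of points of \<open>Z'\<close> occur. A point coming from \<open>Y'\<close> that lies over \<open>g c\<close> forces \<open>c\<close> into
  \<open>m ` W\<close>, and then the left pullback provides the point of \<open>W'\<close>, hence of \<open>X'\<close>, that is looked for.\<close>

lemma front_pullback: "set_pullback X' Z' X g' x z g"
  unfolding set_pullback_def
proof (intro ballI impI)
  fix e c assume e: "e \<in> Z'" and c: "c \<in> X" and ec: "z e = g c"
  show "\<exists>!a. a \<in> X' \<and> g' a = e \<and> x a = c"
  proof (rule ex_ex1I)
    show "\<exists>a. a \<in> X' \<and> g' a = e \<and> x a = c"
    proof (cases "\<exists>a \<in> X' - m' ` W'. e = g' a")
      case True
      then obtain a where a: "a \<in> X'" "a \<notin> m' ` W'" "e = g' a" by blast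
      have eq: "g (x a) = g c" using a front_sq ec by simp
      have xa: "x a \<in> X" "x a \<notin> m ` W" using a outside_image maps by (auto simp: Pi_iff)
      have "c \<notin> m ` W"
      proof
        assume "c \<in> m ` W"
        then obtain b where "b \<in> W" "c = m b" by blast
        then have "g (x a) = n (f b)" "f b \<in> Y" using eq bottom_sq maps by (auto simp: Pi_iff)
        then show False using disj[OF xa(1), of "f b"] xa(2) by blast
      qed
      from g_inj[OF xa c this eq] have "x a = c" .
      then show ?thesis using a by blast
    next
      case False
      then obtain a where a: "a \<in> Y'" "e = n' a" using cover'[OF e] by blast
      then have na: "g c = n (y a)" using ec right_sq by simp
      then obtain b where b: "b \<in> W" "c = m b"
        using disj[OF c, of "y a"] a maps by (auto simp: Pi_iff)
      then have fb: "y a = f b" using na bottom_sq n_inj[of "y a" "f b"] a maps by (auto simp: Pi_iff)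
      obtain b' where "b' \<in> W'" "f' b' = a" "w b' = b"
        by (rule set_pullbackE[OF left_pullback a(1) b(1) fb])
      then have "m' b' \<in> X'" "g' (m' b') = e" "x (m' b') = c"
        using a b top_sq back_sq maps by (auto simp: Pi_iff)
      then show ?thesis by blast
    qed
  next
    fix a b assume a: "a \<in> X' \<and> g' a = e \<and> x a = c" and b: "b \<in> X' \<and> g' b = e \<and> x b = c"
    show "a = b"
    \<comment> \<open>Inside m ` W both points come from W', where the left pullback separates them;
      outside it g' itself is injective.\<close>
    proof (cases "c \<in> m ` W")
      case True
      then obtain a' b' where a': "a' \<in> W'" "a = m' a'" and b': "b' \<in> W'" "b = m' b'"
        using a b outside_image[of a] outside_image[of b] by auto
      have "m (w a') = m (w b')" using a b a' b' back_sq[of a'] back_sq[of b'] by metis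
      then have eq_w: "w a' = w b'"
        using inj_onD[OF inj_m, of "w a'" "w b'"] a' b' maps by (auto simp: Pi_iff)
      have eq_f: "f' a' = f' b'"
        using a b a' b' top_sq[of a'] top_sq[of b'] maps n'_inj[of "f' a'" "f' b'"]
        by (auto simp: Pi_iff)
      have "a' = b'"
        by (rule set_pullback_unique[OF left_pullback maps(6) maps(9) left_sq a'(1) b'(1) eq_f eq_w])
      then show ?thesis using a' b' by simp
    next
      case False
      then show ?thesis using a b outside_image[of a] outside_image[of b] g'_inj[of a b] by auto
    qed
  qed
qed

end

lemma van_kampen_sets:
  "set_gluing W' X' Y' Z' m' g' n' \<longleftrightarrow>
     set_pullback X' Z' X g' x z g \<and> set_pullback Y' Z' Y n' y z n"
  using top_gluing_if right_pullback front_pullback by blast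

end

section \<open>Concrete categories with the pullbacks and gluings of sets\<close>

locale concrete_category = category C for C :: "('o, 'm, 'z) cat_scheme" (structure) +
  fixes U :: "'o \<Rightarrow> 'a set" and app :: "'m \<Rightarrow> 'a \<Rightarrow> 'a"
  assumes app_funcset: "f \<in> Hom C A B \<Longrightarrow> app f \<in> U A \<rightarrow> U B"
    and app_Cmp: "f \<in> Hom C A B \<Longrightarrow> g \<in> Hom C B E \<Longrightarrow> x \<in> U A \<Longrightarrow> app (g \<cdot> f) x = app g (app f x)"
    and app_Ide: "A \<in> Obj C \<Longrightarrow> x \<in> U A \<Longrightarrow> app (Ide C A) x = x"
    and faithful: "f \<in> Hom C A B \<Longrightarrow> g \<in> Hom C A B \<Longrightarrow>
      (\<And>x. x \<in> U A \<Longrightarrow> app f x = app g x) \<Longrightarrow> f = g"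
begin

lemma commutes_iff:
  assumes "f \<in> Hom C W X" "g \<in> Hom C W Y" "p \<in> Hom C X Z" "q \<in> Hom C Y Z"
  shows "commutes C f g p q \<longleftrightarrow> (\<forall>w \<in> U W. app p (app f w) = app q (app g w))"
proof -
  have "p \<cdot> f = q \<cdot> g \<longleftrightarrow> (\<forall>w \<in> U W. app (p \<cdot> f) w = app (q \<cdot> g) w)"
    using faithful[OF Cmp_Hom[OF assms(1,3)] Cmp_Hom[OF assms(2,4)]] by auto
  also have "\<dots> \<longleftrightarrow> (\<forall>w \<in> U W. app p (app f w) = app q (app g w))"
    by (simp add: app_Cmp[OF assms(1,3)] app_Cmp[OF assms(2,4)])
  finally show ?thesis using assms unfolding commutes_def by blast
qed

lemma commutesE:
  assumes "commutes C f g p q"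
  obtains W X Y Z where "f \<in> Hom C W X" "g \<in> Hom C W Y" "p \<in> Hom C X Z" "q \<in> Hom C Y Z"
    "\<And>w. w \<in> U W \<Longrightarrow> app p (app f w) = app q (app g w)"
proof -
  obtain W X Y Z where H: "f \<in> Hom C W X" "g \<in> Hom C W Y" "p \<in> Hom C X Z" "q \<in> Hom C Y Z"
    using assms unfolding commutes_def by blast
  then show ?thesis using assms commutes_iff[OF H] that by blast
qed

lemma cone_Hom:
  assumes "commutes C f g p q" "p \<in> Hom C X Z" "q \<in> Hom C Y Z"
  obtains T where "f \<in> Hom C T X" "g \<in> Hom C T Y"
proof -
  obtain T X' Y' Z' where H: "f \<in> Hom C T X'" "g \<in> Hom C T Y'" "p \<in> Hom C X' Z'" "q \<in> Hom C Y' Z'"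
    using assms(1) unfolding commutes_def by blast
  have "X' = X" "Y' = Y" using H(3,4) assms(2,3) by (auto simp: Hom_def)
  then show ?thesis using that H by simp
qed

lemma cocone_Hom:
  assumes "commutes C f g p q" "f \<in> Hom C W X" "g \<in> Hom C W Y"
  obtains T where "p \<in> Hom C X T" "q \<in> Hom C Y T"
proof -
  obtain W' X' Y' T where H: "f \<in> Hom C W' X'" "g \<in> Hom C W' Y'" "p \<in> Hom C X' T" "q \<in> Hom C Y' T"
    using assms(1) unfolding commutes_def by blast
  have "X' = X" "Y' = Y" using H(1,2) assms(2,3) by (auto simp: Hom_def)
  then show ?thesis using that H by simp
qed

lemma HomD: "f \<in> Hom C A B \<Longrightarrow> Dom C f = A" "f \<in> Hom C A B \<Longrightarrow> Cod C f = B"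
  by (auto simp: Hom_def)

lemma Hom_Obj: "f \<in> Hom C A B \<Longrightarrow> A \<in> Obj C" "f \<in> Hom C A B \<Longrightarrow> B \<in> Obj C"
  using Dom_Obj Cod_Obj by (auto simp: Hom_def)

lemma app_in: "f \<in> Hom C A B \<Longrightarrow> x \<in> U A \<Longrightarrow> app f x \<in> U B"
  using app_funcset by blast

end

text \<open>Two lifting conditions and two existence conditions. The lifting conditions say that a function between
  underlying sets is an arrow as soon as it is compatible with a jointly injective pair of arrows out of its
  target, or with a jointly surjective pair of arrows into its source. With them, every square of arrows whose
  underlying square is a pullback or a gluing of sets has the universal property; the existence conditions then
  show, by comparison, that there are no other pullbacks and no other pushouts along injections.\<close>

locale set_like_category = concrete_category +
  assumes cone_lift:
    "\<lbrakk>f \<in> Hom C P X; g \<in> Hom C P Y; f' \<in> Hom C T X; g' \<in> Hom C T Y;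
      \<And>a b. \<lbrakk>a \<in> U P; b \<in> U P; app f a = app f b; app g a = app g b\<rbrakk> \<Longrightarrow> a = b;
      \<And>t. t \<in> U T \<Longrightarrow> h t \<in> U P \<and> app f (h t) = app f' t \<and> app g (h t) = app g' t\<rbrakk>
     \<Longrightarrow> \<exists>k \<in> Hom C T P. \<forall>t \<in> U T. app k t = h t"
    and cocone_lift:
    "\<lbrakk>g \<in> Hom C X Z; n \<in> Hom C Y Z; g' \<in> Hom C X T; n' \<in> Hom C Y T;
      U Z \<subseteq> app g ` U X \<union> app n ` U Y;
      \<And>a. a \<in> U X \<Longrightarrow> h (app g a) = app g' a; \<And>b. b \<in> U Y \<Longrightarrow> h (app n b) = app n' b\<rbrakk>
     \<Longrightarrow> \<exists>k \<in> Hom C Z T. \<forall>t \<in> U Z. app k t = h t"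
    and pullback_exists:
    "\<lbrakk>p \<in> Hom C X Z; q \<in> Hom C Y Z\<rbrakk> \<Longrightarrow>
      \<exists>P. \<exists>f \<in> Hom C P X. \<exists>g \<in> Hom C P Y. (\<forall>t \<in> U P. app p (app f t) = app q (app g t)) \<and>
        set_pullback (U P) (U X) (U Y) (app f) (app g) (app p) (app q)"
    and gluing_exists:
    "\<lbrakk>m \<in> Hom C W X; f \<in> Hom C W Y; inj_on (app m) (U W)\<rbrakk> \<Longrightarrow>
      \<exists>Z. \<exists>g \<in> Hom C X Z. \<exists>n \<in> Hom C Y Z. (\<forall>t \<in> U W. app g (app m t) = app n (app f t)) \<and>
        set_gluing (U W) (U X) (U Y) (U Z) (app m) (app g) (app n)"
begin

lemma pullback_if_set_pullback:
  assumes f: "f \<in> Hom C W X" and g: "g \<in> Hom C W Y" and p: "p \<in> Hom C X Z" and q: "q \<in> Hom C Y Z"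
    and comm: "commutes C f g p q"
    and pb: "set_pullback (U W) (U X) (U Y) (app f) (app g) (app p) (app q)"
  shows "pullback C f g p q"
  unfolding pullback_def
proof (intro conjI allI impI)
  show "commutes C f g p q" by fact
  fix f' g' assume comm': "commutes C f' g' p q"
  obtain T where f': "f' \<in> Hom C T X" and g': "g' \<in> Hom C T Y"
    by (rule cone_Hom[OF comm' p q])
  have sq: "app p (app f w) = app q (app g w)" if "w \<in> U W" for w
    using comm that commutes_iff[OF f g p q] by blast
  have sq': "app p (app f' t) = app q (app g' t)" if "t \<in> U T" for t
    using comm' that commutes_iff[OF f' g' p q] by blast
  have joint: "a = b" if "a \<in> U W" "b \<in> U W" "app f a = app f b" "app g a = app g b" for a b
    by (rule set_pullback_unique[OF pb app_funcset[OF f] app_funcset[OF g] sq that])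
  have "\<exists>w. w \<in> U W \<and> app f w = app f' t \<and> app g w = app g' t" if t: "t \<in> U T" for t
    by (rule set_pullbackE[OF pb app_in[OF f' t] app_in[OF g' t] sq'[OF t]]) blast
  then have "\<forall>t. \<exists>w. t \<in> U T \<longrightarrow> w \<in> U W \<and> app f w = app f' t \<and> app g w = app g' t" by blast
  from choice[OF this] obtain h
    where h: "\<And>t. t \<in> U T \<Longrightarrow> h t \<in> U W \<and> app f (h t) = app f' t \<and> app g (h t) = app g' t" by blast
  have "\<exists>k \<in> Hom C T W. \<forall>t \<in> U T. app k t = h t"
    by (rule cone_lift[OF f g f' g' joint h])
  then obtain k where k: "k \<in> Hom C T W" "\<forall>t \<in> U T. app k t = h t" by blast
  have key: "(k' \<in> Hom C T W \<and> f \<cdot> k' = f' \<and> g \<cdot> k' = g') \<longleftrightarrow> k' = k" for k'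
  proof
    assume k': "k' \<in> Hom C T W \<and> f \<cdot> k' = f' \<and> g \<cdot> k' = g'"
    then have k'_Hom: "k' \<in> Hom C T W" and f_k': "f \<cdot> k' = f'" and g_k': "g \<cdot> k' = g'" by auto
    show "k' = k"
    proof (rule faithful[OF k'_Hom k(1)])
      fix t assume t: "t \<in> U T"
      show "app k' t = app k t"
        using app_Cmp[OF k'_Hom f t] app_Cmp[OF k'_Hom g t] h[OF t] k(2) t f_k' g_k'
        by (intro joint[OF app_in[OF k'_Hom t] app_in[OF k(1) t]]) auto
    qed
  next
    assume "k' = k"
    moreover have "f \<cdot> k = f'"
      using k h app_Cmp[OF k(1) f] by (intro faithful[OF Cmp_Hom[OF k(1) f] f']) auto
    moreover have "g \<cdot> k = g'"
      using k h app_Cmp[OF k(1) g] by (intro faithful[OF Cmp_Hom[OF k(1) g] g']) auto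
    ultimately show "k' \<in> Hom C T W \<and> f \<cdot> k' = f' \<and> g \<cdot> k' = g'" using k by simp
  qed
  show "\<exists>!h. h \<in> Hom C (Dom C f') (Dom C f) \<and> f \<cdot> h = f' \<and> g \<cdot> h = g'"
    using key HomD f f' by (intro ex1I[of _ k]) auto
qed

text \<open>The comparison arrows with a pullback that is known to be a fibre product of sets are mutually inverse, and
  the fibre product property moves along them.\<close>

lemma set_pullback_if_pullback:
  assumes f: "f \<in> Hom C W X" and g: "g \<in> Hom C W Y" and p: "p \<in> Hom C X Z" and q: "q \<in> Hom C Y Z"
    and pb: "pullback C f g p q"
  shows "set_pullback (U W) (U X) (U Y) (app f) (app g) (app p) (app q)"
proof -
  obtain P f0 g0 where f0: "f0 \<in> Hom C P X" and g0: "g0 \<in> Hom C P Y"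
    and sq0: "\<forall>t \<in> U P. app p (app f0 t) = app q (app g0 t)"
    and pb0: "set_pullback (U P) (U X) (U Y) (app f0) (app g0) (app p) (app q)"
    using pullback_exists[OF p q] by blast
  have comm0: "commutes C f0 g0 p q" using commutes_iff[OF f0 g0 p q] sq0 by blast
  have comm: "commutes C f g p q" using pb unfolding pullback_def by blast
  have "pullback C f0 g0 p q" by (rule pullback_if_set_pullback[OF f0 g0 p q comm0 pb0])
  then obtain k where k: "k \<in> Hom C W P" "f0 \<cdot> k = f" "g0 \<cdot> k = g"
    using comm HomD f f0 unfolding pullback_def by metis
  obtain l where l: "l \<in> Hom C P W" "f \<cdot> l = f0" "g \<cdot> l = g0"
    using comm0 pb HomD f f0 unfolding pullback_def by metis
  have "\<exists>!h. h \<in> Hom C W W \<and> f \<cdot> h = f \<and> g \<cdot> h = g"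
    using pb comm HomD f unfolding pullback_def by metis
  moreover have "l \<cdot> k \<in> Hom C W W" "f \<cdot> (l \<cdot> k) = f" "g \<cdot> (l \<cdot> k) = g"
    using Cmp_Hom Cmp_assoc[OF k(1) l(1) f] Cmp_assoc[OF k(1) l(1) g] k l by auto
  moreover have "Ide C W \<in> Hom C W W" "f \<cdot> Ide C W = f" "g \<cdot> Ide C W = g"
    using Ide_Hom Cmp_Ide f g Hom_Obj by auto
  ultimately have lk: "l \<cdot> k = Ide C W" by metis
  have lk_app: "app l (app k w) = w" if "w \<in> U W" for w
    using app_Cmp[OF k(1) l(1) that] app_Ide that lk Hom_Obj f by metis
  have f_l: "app f (app l t) = app f0 t" "app g (app l t) = app g0 t" if "t \<in> U P" for t
    using app_Cmp[OF l(1) f that] app_Cmp[OF l(1) g that] l by auto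
  have f_k: "app f0 (app k w) = app f w" "app g0 (app k w) = app g w" if "w \<in> U W" for w
    using app_Cmp[OF k(1) f0 that] app_Cmp[OF k(1) g0 that] k by auto
  show ?thesis unfolding set_pullback_def
  proof (intro ballI impI)
    fix x y assume xy: "x \<in> U X" "y \<in> U Y" "app p x = app q y"
    obtain t where t: "t \<in> U P" "app f0 t = x" "app g0 t = y"
      using set_pullbackE[OF pb0 xy] by metis
    show "\<exists>!w. w \<in> U W \<and> app f w = x \<and> app g w = y"
    proof (rule ex1I[of _ "app l t"])
      show "app l t \<in> U W \<and> app f (app l t) = x \<and> app g (app l t) = y"
        using t f_l app_in[OF l(1)] by auto
      fix w assume w: "w \<in> U W \<and> app f w = x \<and> app g w = y"
      have kw: "app k w \<in> U P" "app f0 (app k w) = app f0 t" "app g0 (app k w) = app g0 t"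
        using w t f_k app_in[OF k(1)] by auto
      have "app k w = t"
        by (rule set_pullback_unique[OF pb0 app_funcset[OF f0] app_funcset[OF g0] _ kw(1) t(1) kw(2,3)])
          (use sq0 in blast)
      then show "w = app l t" using lk_app[of w] w by simp
    qed
  qed
qed

lemma pullback_iff:
  assumes "f \<in> Hom C W X" "g \<in> Hom C W Y" "p \<in> Hom C X Z" "q \<in> Hom C Y Z" "commutes C f g p q"
  shows "pullback C f g p q \<longleftrightarrow> set_pullback (U W) (U X) (U Y) (app f) (app g) (app p) (app q)"
  using assms pullback_if_set_pullback set_pullback_if_pullback by blast

text \<open>Two points identified by \<open>m\<close> form a point of the underlying set of the pullback of \<open>m\<close> with itself, whose two
  projections are equal if \<open>m\<close> is mono.\<close>

lemma mono_inj:
  assumes m: "m \<in> Hom C W X" and mono: "mono_arr C m"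
  shows "inj_on (app m) (U W)"
proof (rule inj_onI)
  fix a b assume ab: "a \<in> U W" "b \<in> U W" "app m a = app m b"
  obtain P f g where f: "f \<in> Hom C P W" and g: "g \<in> Hom C P W"
    and sq: "\<forall>t \<in> U P. app m (app f t) = app m (app g t)"
    and pb: "set_pullback (U P) (U W) (U W) (app f) (app g) (app m) (app m)"
    using pullback_exists[OF m m] by blast
  have "m \<cdot> f = m \<cdot> g" using commutes_iff[OF f g m m] sq unfolding commutes_def by blast
  then have "f = g" using mono f g m HomD unfolding mono_arr_def by metis
  moreover obtain t where "app f t = a" "app g t = b" using set_pullbackE[OF pb ab] by metis
  ultimately show "a = b" by simp
qed

lemma pushout_if_set_gluing:
  assumes m: "m \<in> Hom C W X" and f: "f \<in> Hom C W Y" and g: "g \<in> Hom C X Z" and n: "n \<in> Hom C Y Z"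
    and comm: "commutes C m f g n"
    and gl: "set_gluing (U W) (U X) (U Y) (U Z) (app m) (app g) (app n)"
  shows "pushout C m f g n"
  unfolding pushout_def
proof (intro conjI allI impI)
  show "commutes C m f g n" by fact
  fix g' n' assume comm': "commutes C m f g' n'"
  obtain T where g': "g' \<in> Hom C X T" and n': "n' \<in> Hom C Y T"
    by (rule cocone_Hom[OF comm' m f])
  have sq: "app g (app m w) = app n (app f w)" if "w \<in> U W" for w
    using comm that commutes_iff[OF m f g n] by blast
  have sq': "app g' (app m w) = app n' (app f w)" if "w \<in> U W" for w
    using comm' that commutes_iff[OF m f g' n'] by blast
  let ?X = "U X - app m ` U W"
  \<comment> \<open>On g ` (X - m ` W) and n ` Y the mediating function is forced; injectivity of g and n there
    and disjointness of the two images make it well defined.\<close>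
  define h where "h c = (if c \<in> app n ` U Y then app n' (inv_into (U Y) (app n) c)
      else app g' (inv_into ?X (app g) c))" for c
  have inj: "inj_on (app n) (U Y)" "inj_on (app g) ?X" "app g ` ?X \<inter> app n ` U Y = {}"
    and cov: "U Z \<subseteq> app g ` ?X \<union> app n ` U Y"
    using gl unfolding set_gluing_def by auto
  have hn: "h (app n b) = app n' b" if "b \<in> U Y" for b
    using that inj by (simp add: h_def)
  have hg: "h (app g a) = app g' a" if a: "a \<in> U X" for a
  proof (cases "a \<in> app m ` U W")
    case True
    then obtain w where "w \<in> U W" "a = app m w" by blast
    then show ?thesis using hn sq sq' app_in[OF f] by simp
  next
    case False
    then have "app g a \<notin> app n ` U Y" using inj(3) a by blast
    then show ?thesis using inj(2) False a by (simp add: h_def)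
  qed
  have cov': "U Z \<subseteq> app g ` U X \<union> app n ` U Y" using cov by blast
  have "\<exists>k \<in> Hom C Z T. \<forall>t \<in> U Z. app k t = h t"
    by (rule cocone_lift[OF g n g' n' cov' hg hn])
  then obtain k where k: "k \<in> Hom C Z T" "\<forall>t \<in> U Z. app k t = h t" by blast
  have key: "(k' \<in> Hom C Z T \<and> k' \<cdot> g = g' \<and> k' \<cdot> n = n') \<longleftrightarrow> k' = k" for k'
  proof
    assume k': "k' \<in> Hom C Z T \<and> k' \<cdot> g = g' \<and> k' \<cdot> n = n'"
    then have k'_Hom: "k' \<in> Hom C Z T" and k'_g: "k' \<cdot> g = g'" and k'_n: "k' \<cdot> n = n'" by auto
    show "k' = k"
    proof (rule faithful[OF k'_Hom k(1)])
      fix c assume c: "c \<in> U Z"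
      consider a where "a \<in> U X" "c = app g a" | b where "b \<in> U Y" "c = app n b"
        using cov' c by blast
      then show "app k' c = app k c"
        using k(2) c hg hn app_Cmp[OF g k'_Hom] app_Cmp[OF n k'_Hom] k'_g k'_n by cases auto
    qed
  next
    assume "k' = k"
    moreover have "k \<cdot> g = g'"
      using k hg app_Cmp[OF g k(1)] app_in[OF g] by (intro faithful[OF Cmp_Hom[OF g k(1)] g']) auto
    moreover have "k \<cdot> n = n'"
      using k hn app_Cmp[OF n k(1)] app_in[OF n] by (intro faithful[OF Cmp_Hom[OF n k(1)] n']) auto
    ultimately show "k' \<in> Hom C Z T \<and> k' \<cdot> g = g' \<and> k' \<cdot> n = n'" using k by simp
  qed
  show "\<exists>!h. h \<in> Hom C (Cod C g) (Cod C g') \<and> h \<cdot> g = g' \<and> h \<cdot> n = n'"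
    using key HomD g g' by (intro ex1I[of _ k]) auto
qed

text \<open>As for pullbacks: the given pushout is compared with one that is known to be a gluing of sets.\<close>

lemma set_gluing_if_pushout:
  assumes m: "m \<in> Hom C W X" and f: "f \<in> Hom C W Y" and g: "g \<in> Hom C X Z" and n: "n \<in> Hom C Y Z"
    and inj: "inj_on (app m) (U W)" and po: "pushout C m f g n"
  shows "set_gluing (U W) (U X) (U Y) (U Z) (app m) (app g) (app n)"
proof -
  obtain Z0 g0 n0 where g0: "g0 \<in> Hom C X Z0" and n0: "n0 \<in> Hom C Y Z0"
    and sq0: "\<forall>t \<in> U W. app g0 (app m t) = app n0 (app f t)"
    and gl0: "set_gluing (U W) (U X) (U Y) (U Z0) (app m) (app g0) (app n0)"
    using gluing_exists[OF m f inj] by blast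
  have comm0: "commutes C m f g0 n0" using commutes_iff[OF m f g0 n0] sq0 by blast
  have comm: "commutes C m f g n" using po unfolding pushout_def by blast
  have "pushout C m f g0 n0" by (rule pushout_if_set_gluing[OF m f g0 n0 comm0 gl0])
  then obtain l where l: "l \<in> Hom C Z0 Z" "l \<cdot> g0 = g" "l \<cdot> n0 = n"
    using comm HomD g g0 unfolding pushout_def by metis
  obtain k where k: "k \<in> Hom C Z Z0" "k \<cdot> g = g0" "k \<cdot> n = n0"
    using comm0 po HomD g g0 unfolding pushout_def by metis
  have "\<exists>!h. h \<in> Hom C Z Z \<and> h \<cdot> g = g \<and> h \<cdot> n = n"
    using po comm HomD g unfolding pushout_def by metis
  moreover have "l \<cdot> k \<in> Hom C Z Z" "(l \<cdot> k) \<cdot> g = g" "(l \<cdot> k) \<cdot> n = n"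
    using Cmp_Hom Cmp_assoc[OF g k(1) l(1)] Cmp_assoc[OF n k(1) l(1)] k l by auto
  moreover have "Ide C Z \<in> Hom C Z Z" "Ide C Z \<cdot> g = g" "Ide C Z \<cdot> n = n"
    using Ide_Hom Ide_Cmp g n Hom_Obj by auto
  ultimately have lk: "l \<cdot> k = Ide C Z" by metis
  have lk_app: "app l (app k c) = c" if "c \<in> U Z" for c
    using app_Cmp[OF k(1) l(1) that] app_Ide that lk Hom_Obj g by metis
  have k_g: "app k (app g a) = app g0 a" if "a \<in> U X" for a
    using app_Cmp[OF g k(1) that] k by simp
  have k_n: "app k (app n b) = app n0 b" if "b \<in> U Y" for b
    using app_Cmp[OF n k(1) that] k by simp
  let ?X = "U X - app m ` U W"
  have inj0: "inj_on (app n0) (U Y)" "inj_on (app g0) ?X" "app g0 ` ?X \<inter> app n0 ` U Y = {}"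
    "U Z0 \<subseteq> app g0 ` ?X \<union> app n0 ` U Y"
    using gl0 unfolding set_gluing_def by auto
  show ?thesis unfolding set_gluing_def
  proof (intro conjI)
    show "inj_on (app n) (U Y)"
    proof (rule inj_onI)
      fix a b assume ab: "a \<in> U Y" "b \<in> U Y" "app n a = app n b"
      then have "app n0 a = app n0 b" using k_n[of a] k_n[of b] by simp
      then show "a = b" using inj_onD[OF inj0(1) _ ab(1,2)] by blast
    qed
    show "inj_on (app g) ?X"
    proof (rule inj_onI)
      fix a b assume ab: "a \<in> ?X" "b \<in> ?X" "app g a = app g b"
      then have "app g0 a = app g0 b" using k_g[of a] k_g[of b] by simp
      then show "a = b" using inj_onD[OF inj0(2) _ ab(1,2)] by blast
    qed
    have False if ab: "a \<in> ?X" "b \<in> U Y" "app g a = app n b" for a b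
    proof -
      have "app g0 a = app n0 b" using ab k_g[of a] k_n[of b] by simp
      then have "app n0 b \<in> app g0 ` ?X \<inter> app n0 ` U Y" using ab(1,2) by (metis IntI imageI)
      then show False unfolding inj0(3) by simp
    qed
    then show "app g ` ?X \<inter> app n ` U Y = {}" by blast
    show "U Z \<subseteq> app g ` ?X \<union> app n ` U Y"
    proof
      fix c assume c: "c \<in> U Z"
      have k_inj: "c = d" if "d \<in> U Z" "app k c = app k d" for d
        using arg_cong[OF that(2), of "app l"] unfolding lk_app[OF c] lk_app[OF that(1)] .
      have "app k c \<in> app g0 ` ?X \<union> app n0 ` U Y" using inj0(4) app_in[OF k(1) c] by (rule subsetD)
      then consider a where "a \<in> ?X" "app k c = app g0 a" | b where "b \<in> U Y" "app k c = app n0 b"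
        by (elim UnE imageE) (simp_all only:)
      then show "c \<in> app g ` ?X \<union> app n ` U Y"
      proof cases
        case 1
        then have "c = app g a" using app_in[OF g] k_g by (intro k_inj) auto
        then show ?thesis using 1(1) by (metis UnI1 imageI)
      next
        case 2
        then have "c = app n b" using app_in[OF n] k_n by (intro k_inj) auto
        then show ?thesis using 2(1) by (metis UnI2 imageI)
      qed
    qed
  qed
qed

lemma pushout_iff:
  assumes "m \<in> Hom C W X" "f \<in> Hom C W Y" "g \<in> Hom C X Z" "n \<in> Hom C Y Z"
    "inj_on (app m) (U W)" "commutes C m f g n"
  shows "pushout C m f g n \<longleftrightarrow> set_gluing (U W) (U X) (U Y) (U Z) (app m) (app g) (app n)"
  using assms pushout_if_set_gluing set_gluing_if_pushout by blast

text \<open>All pullbacks and pushouts of the cube are now conditions on underlying sets. The top edge \<open>m'\<close> is injective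
  because it is a pullback of \<open>m\<close>, which makes the criterion for pushouts applicable to the top face.\<close>

lemma pushout_van_kampen:
  assumes mono: "mono_arr C m" and po: "pushout C m f g n"
  shows "van_kampen C m f g n"
  unfolding van_kampen_def
proof (intro allI impI, elim conjE)
  fix m' f' g' n' w x y z
  assume comm: "commutes C m f g n" and comm': "commutes C m' f' g' n'"
    and cb: "commutes C m' w x m" and cl: "commutes C f' w y f"
    and cf: "commutes C g' x z g" and cr: "commutes C n' y z n"
    and pb: "pullback C m' w x m" and pl: "pullback C f' w y f"
  obtain W X Y Z where bot: "m \<in> Hom C W X" "f \<in> Hom C W Y" "g \<in> Hom C X Z" "n \<in> Hom C Y Z"
    and bot_sq: "\<And>a. a \<in> U W \<Longrightarrow> app g (app m a) = app n (app f a)"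
    using commutesE[OF comm] by metis
  obtain W' X' Y' Z' where top: "m' \<in> Hom C W' X'" "f' \<in> Hom C W' Y'" "g' \<in> Hom C X' Z'" "n' \<in> Hom C Y' Z'"
    and top_sq: "\<And>a. a \<in> U W' \<Longrightarrow> app g' (app m' a) = app n' (app f' a)"
    using commutesE[OF comm'] by metis
  have w: "w \<in> Hom C W' W" and x: "x \<in> Hom C X' X" and y: "y \<in> Hom C Y' Y" and z: "z \<in> Hom C Z' Z"
    using cb cl cf cr bot top unfolding commutes_def Hom_def by auto
  have inj_m: "inj_on (app m) (U W)" using mono_inj bot mono by blast
  have spb: "set_pullback (U W') (U X') (U W) (app m') (app w) (app x) (app m)"
    using pullback_iff[OF top(1) w x bot(1) cb] pb by blast
  have spl: "set_pullback (U W') (U Y') (U W) (app f') (app w) (app y) (app f)"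
    using pullback_iff[OF top(2) w y bot(2) cl] pl by blast
  have bsq: "app x (app m' a) = app m (app w a)" if "a \<in> U W'" for a
    using commutes_iff[OF top(1) w x bot(1)] cb that by blast
  interpret set_cube "U W" "U X" "U Y" "U Z" "U W'" "U X'" "U Y'" "U Z'" "app m" "app f" "app g" "app n"
    "app m'" "app f'" "app g'" "app n'" "app w" "app x" "app y" "app z"
  proof
    show "set_gluing (U W) (U X) (U Y) (U Z) (app m) (app g) (app n)"
      by (rule set_gluing_if_pushout[OF bot inj_m po])
    show "app y (app f' a) = app f (app w a)" if "a \<in> U W'" for a
      using commutes_iff[OF top(2) w y bot(2)] cl that by blast
    show "app z (app g' a) = app g (app x a)" if "a \<in> U X'" for a
      using commutes_iff[OF top(3) x z bot(3)] cf that by blast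
    show "app z (app n' a) = app n (app y a)" if "a \<in> U Y'" for a
      using commutes_iff[OF top(4) y z bot(4)] cr that by blast
  qed (fact bot_sq top_sq bsq inj_m spb spl app_funcset[OF bot(1)] app_funcset[OF bot(2)]
      app_funcset[OF bot(3)] app_funcset[OF bot(4)] app_funcset[OF top(1)] app_funcset[OF top(2)]
      app_funcset[OF top(3)] app_funcset[OF top(4)] app_funcset[OF w] app_funcset[OF x]
      app_funcset[OF y] app_funcset[OF z])+
  have inj_m': "inj_on (app m') (U W')"
  proof (rule inj_onI)
    fix a b assume ab: "a \<in> U W'" "b \<in> U W'" "app m' a = app m' b"
    have "app m (app w a) = app m (app w b)" using ab bsq by metis
    then have w_ab: "app w a = app w b"
      by (rule inj_onD[OF inj_m _ app_in[OF w ab(1)] app_in[OF w ab(2)]])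
    show "a = b"
      by (rule set_pullback_unique[OF spb app_funcset[OF top(1)] app_funcset[OF w] bsq ab w_ab])
  qed
  show "pushout C m' f' g' n' \<longleftrightarrow> pullback C g' x z g \<and> pullback C n' y z n"
    using pushout_iff[OF top inj_m' comm'] pullback_iff[OF top(3) x z bot(3) cf]
      pullback_iff[OF top(4) y z bot(4) cr] van_kampen_sets by simp
qed

theorem adhesive: "adhesive C"
  unfolding adhesive_def
proof (intro conjI allI impI)
  show "category C" by unfold_locales
  show "has_pullbacks C" unfolding has_pullbacks_def
  proof (intro allI ballI)
    fix X Y Z p q assume p: "p \<in> Hom C X Z" and q: "q \<in> Hom C Y Z"
    then obtain P f g where f: "f \<in> Hom C P X" and g: "g \<in> Hom C P Y"
      and sq: "\<forall>t \<in> U P. app p (app f t) = app q (app g t)"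
      and pb: "set_pullback (U P) (U X) (U Y) (app f) (app g) (app p) (app q)"
      using pullback_exists by meson
    show "\<exists>f g. pullback C f g p q"
      using pullback_if_set_pullback[OF f g p q _ pb] commutes_iff[OF f g p q] sq by blast
  qed
  show "has_pushouts_along_monos C" unfolding has_pushouts_along_monos_def
  proof (intro allI ballI impI)
    fix W X Y m f assume m: "m \<in> Hom C W X" and f: "f \<in> Hom C W Y" and "mono_arr C m"
    then have inj: "inj_on (app m) (U W)" using mono_inj by blast
    then obtain Z g n where g: "g \<in> Hom C X Z" and n: "n \<in> Hom C Y Z"
      and sq: "\<forall>t \<in> U W. app g (app m t) = app n (app f t)"
      and gl: "set_gluing (U W) (U X) (U Y) (U Z) (app m) (app g) (app n)"
      using gluing_exists[OF m f] by blast
    show "\<exists>p q. pushout C m f p q"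
      using pushout_if_set_gluing[OF m f g n _ gl] commutes_iff[OF m f g n] sq by blast
  qed
qed (use pushout_van_kampen in blast)

end

section \<open>Definable functions\<close>

definition select :: "nat list \<Rightarrow> real list \<Rightarrow> real list" where
  "select \<sigma> v = map (\<lambda>i. v ! i) \<sigma>"

lemma length_select [simp]: "length (select \<sigma> v) = length \<sigma>"
  by (simp add: select_def)

lemma select_append [simp]: "select (\<sigma> @ \<tau>) v = select \<sigma> v @ select \<tau> v"
  by (simp add: select_def)

lemma select_block:
  assumes "length u = a" "a + length v = b"
  shows "select [a..<b] (u @ v @ w) = v"
  using assms by (intro nth_equalityI) (auto simp: select_def nth_append)

lemma select_block_end:
  assumes "length u = a" "a + length v = b"
  shows "select [a..<b] (u @ v) = v"
  using select_block[of u a v b "[]"] assms by simp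

lemma select_block_start:
  assumes "length v = b"
  shows "select [0..<b] (v @ w) = v"
  using select_block[of "[]" 0 v b w] assms by simp

lemma select_all: "length v = b \<Longrightarrow> select [0..<b] v = v"
  using select_block_start[of v b "[]"] by simp

lemma select_take: "n + k = length v \<Longrightarrow> select [0..<n] v = take n v"
  using select_block_start[of "take n v" n "drop n v"] by simp

lemma select_drop: "n + k = length v \<Longrightarrow> select [n..<n + k] v = drop n v"
  using select_block_end[of "take n v" n "drop n v" "n + k"] by simp

lemma cprod_iff: "z \<in> cprod A B \<longleftrightarrow> (\<exists>x \<in> A. \<exists>y \<in> B. z = x @ y)"
  by (auto simp: cprod_def)

context o_minimal
begin

lemma D_length:
  assumes "1 \<le> n" "A \<in> D n" "x \<in> A"
  shows "length x = n"
proof -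
  interpret algebra "Rn n" "D n" by (rule boolean_algebra[OF assms(1)])
  show ?thesis using sets_into_space[OF assms(2)] assms(3) by (auto simp: Rn_def)
qed

lemma
  assumes "1 \<le> n"
  shows D_Un: "A \<in> D n \<Longrightarrow> B \<in> D n \<Longrightarrow> A \<union> B \<in> D n"
    and D_Int: "A \<in> D n \<Longrightarrow> B \<in> D n \<Longrightarrow> A \<inter> B \<in> D n"
    and D_Diff: "A \<in> D n \<Longrightarrow> B \<in> D n \<Longrightarrow> A - B \<in> D n"
    and D_empty: "{} \<in> D n"
    and D_Rn: "Rn n \<in> D n"
proof -
  interpret algebra "Rn n" "D n" by (rule boolean_algebra[OF assms])
  show "A \<union> B \<in> D n" if "A \<in> D n" "B \<in> D n" by (rule Un[OF that])
  show "A \<inter> B \<in> D n" if "A \<in> D n" "B \<in> D n" by (rule Int[OF that])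
  show "A - B \<in> D n" if "A \<in> D n" "B \<in> D n" by (rule Diff[OF that])
  show "{} \<in> D n" by (rule empty_sets)
  show "Rn n \<in> D n" by (rule top)
qed

lemma D_zero_set:
  assumes "1 \<le> n" "poly_fun n p" "A \<in> D n"
  shows "{v \<in> A. p v = 0} \<in> D n"
proof -
  have "{v \<in> A. p v = 0} = A \<inter> {v \<in> Rn n. p v = 0}"
    using D_length[OF assms(1,3)] by (auto simp: Rn_def)
  moreover have "{v \<in> Rn n. p v = 0} \<in> D n"
    using semialgebraic[OF assms(1)] semialgebraic.eq[OF assms(2)] by blast
  ultimately show ?thesis using D_Int assms by simp
qed

lemma D_coords_eq:
  assumes "length \<sigma> = length \<tau>" "1 \<le> n" "A \<in> D n" "set \<sigma> \<subseteq> {..<n}" "set \<tau> \<subseteq> {..<n}"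
  shows "{v \<in> A. select \<sigma> v = select \<tau> v} \<in> D n"
  using assms
proof (induction \<sigma> \<tau> rule: list_induct2)
  case Nil
  then show ?case by (simp add: select_def)
next
  case (Cons i \<sigma> j \<tau>)
  \<comment> \<open>Polynomials have no subtraction among their formation rules.\<close>
  have "poly_fun n (\<lambda>v. v ! i + (-1) * v ! j)"
    by (intro poly_fun.intros) (use Cons in auto)
  then have "{v \<in> {v \<in> A. select \<sigma> v = select \<tau> v}. v ! i + (-1) * v ! j = 0} \<in> D n"
    using Cons by (intro D_zero_set) auto
  moreover have "{v \<in> {v \<in> A. select \<sigma> v = select \<tau> v}. v ! i + (-1) * v ! j = 0} =
      {v \<in> A. select (i # \<sigma>) v = select (j # \<tau>) v}"
    by (auto simp: select_def)
  ultimately show ?case by simp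
qed

text \<open>The structure is closed under dropping one coordinate; iterating gives existential quantification over any
  block of trailing coordinates.\<close>

lemma D_take:
  assumes "1 \<le> n" "A \<in> D (n + k)"
  shows "take n ` A \<in> D n"
  using assms(2)
proof (induction k arbitrary: A)
  case 0
  then have "take n ` A = A" using D_length[of n A] assms(1) by force
  then show ?case using 0 by simp
next
  case (Suc k)
  then have "take (n + k) ` A \<in> D (n + k)" using projection[of "n + k" A] assms(1) by simp
  then have "take n ` (take (n + k) ` A) \<in> D n" by (rule Suc.IH)
  moreover have "take n ` (take (n + k) ` A) = take n ` A" by (simp add: image_image min_def)
  ultimately show ?case by simp
qed

text \<open>Permuting, duplicating and omitting coordinates. The projections of the structure only omit trailing
  coordinates, so the selected coordinates are first written in front of the point and then the point is
  projected away. Together with products and equations between coordinates this yields composition, pairing, images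
  and inverses of definable functions.\<close>

lemma D_select_image:
  assumes "1 \<le> n" "A \<in> D n" "set \<sigma> \<subseteq> {..<n}" "\<sigma> \<noteq> []"
  shows "select \<sigma> ` A \<in> D (length \<sigma>)"
proof -
  let ?p = "length \<sigma>"
  let ?S = "{v \<in> cprod (Rn ?p) A. select [0..<?p] v = select (map ((+) ?p) \<sigma>) v}"
  have p: "1 \<le> ?p" using assms(4) by (cases \<sigma>) auto
  have "?S \<in> D (?p + n)"
    using assms p by (intro D_coords_eq product D_Rn) auto
  then have "take ?p ` ?S \<in> D ?p" by (rule D_take[OF p])
  moreover have sel: "select (map ((+) ?p) \<sigma>) (u @ w) = select \<sigma> w" if "length u = ?p" for u w
    using that by (simp add: select_def nth_append)
  have "take ?p ` ?S = select \<sigma> ` A"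
  proof
    show "take ?p ` ?S \<subseteq> select \<sigma> ` A"
      using sel by (auto simp: cprod_iff Rn_def select_block_start)
    show "select \<sigma> ` A \<subseteq> take ?p ` ?S"
    proof
      fix u assume "u \<in> select \<sigma> ` A"
      then obtain w where w: "w \<in> A" "u = select \<sigma> w" by blast
      then have "u @ w \<in> ?S" "u = take ?p (u @ w)"
        using sel[of u w] by (auto simp: cprod_def Rn_def select_block_start intro!: exI)
      then show "u \<in> take ?p ` ?S" by blast
    qed
  qed
  ultimately show ?thesis by simp
qed

text \<open>The dimensions are part of the predicate because the empty set, and with it the graph of the empty function,
  lies in every dimension.\<close>

definition definable_on :: "nat \<Rightarrow> nat \<Rightarrow> real list set \<Rightarrow> (real list \<Rightarrow> real list) \<Rightarrow> bool" where
  "definable_on n k A f \<longleftrightarrow> 1 \<le> n \<and> 1 \<le> k \<and> A \<in> D n \<and> (\<forall>x \<in> A. length (f x) = k) \<and>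
     (\<lambda>x. x @ f x) ` A \<in> D (n + k)"

lemma definable_onD:
  assumes "definable_on n k A f"
  shows "1 \<le> n" "1 \<le> k" "A \<in> D n" "(\<lambda>x. x @ f x) ` A \<in> D (n + k)"
    "x \<in> A \<Longrightarrow> length x = n" "x \<in> A \<Longrightarrow> length (f x) = k"
  using assms D_length unfolding definable_on_def by auto

lemma definable_on_cong:
  assumes "definable_on n k A f" "\<And>x. x \<in> A \<Longrightarrow> f x = g x"
  shows "definable_on n k A g"
proof -
  have "(\<lambda>x. x @ f x) ` A = (\<lambda>x. x @ g x) ` A" using assms(2) by (intro image_cong) auto
  then show ?thesis using assms unfolding definable_on_def by auto
qed

lemma definable_on_select:
  assumes "1 \<le> n" "A \<in> D n" "set \<sigma> \<subseteq> {..<n}" "\<sigma> \<noteq> []"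
  shows "definable_on n (length \<sigma>) A (select \<sigma>)"
proof -
  have "select ([0..<n] @ \<sigma>) ` A \<in> D (length ([0..<n] @ \<sigma>))"
    using assms by (intro D_select_image) auto
  moreover have "select ([0..<n] @ \<sigma>) ` A = (\<lambda>x. x @ select \<sigma> x) ` A"
    using D_length[OF assms(1,2)] by (intro image_cong) (auto simp: select_all)
  moreover have "1 \<le> length \<sigma>" using assms(4) by (cases \<sigma>) auto
  ultimately show ?thesis using assms unfolding definable_on_def by simp
qed

lemma definable_on_take:
  assumes "1 \<le> n" "1 \<le> l" "A \<in> D (n + l)"
  shows "definable_on (n + l) n A (take n)"
proof -
  have "definable_on (n + l) (length [0..<n]) A (select [0..<n])"
    using assms by (intro definable_on_select) auto
  then have sel: "definable_on (n + l) n A (select [0..<n])" by simp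
  show ?thesis
    by (rule definable_on_cong[OF sel]) (use D_length[of "n + l" A] assms in \<open>simp add: select_take\<close>)
qed

lemma definable_on_drop:
  assumes "1 \<le> n" "1 \<le> l" "A \<in> D (n + l)"
  shows "definable_on (n + l) l A (drop n)"
proof -
  have "definable_on (n + l) (length [n..<n + l]) A (select [n..<n + l])"
    using assms by (intro definable_on_select) auto
  then have sel: "definable_on (n + l) l A (select [n..<n + l])" by simp
  show ?thesis
    by (rule definable_on_cong[OF sel]) (use D_length[of "n + l" A] assms in \<open>simp add: select_drop\<close>)
qed

lemma definable_on_id:
  assumes "1 \<le> n" "A \<in> D n"
  shows "definable_on n n A (\<lambda>x. x)"
proof -
  have "definable_on n (length [0..<n]) A (select [0..<n])"
    using assms by (intro definable_on_select) auto
  then have sel: "definable_on n n A (select [0..<n])" by simp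
  show ?thesis
    by (rule definable_on_cong[OF sel]) (use D_length[of n A] assms in \<open>simp add: select_all\<close>)
qed

lemma D_singleton:
  assumes "c \<noteq> []"
  shows "{c} \<in> D (length c)"
proof -
  let ?n = "length c"
  have n: "1 \<le> ?n" using assms by (cases c) auto
  have prefix: "{v \<in> Rn ?n. \<forall>i < k. v ! i = c ! i} \<in> D ?n" if "k \<le> ?n" for k
    using that
  proof (induction k)
    case 0
    then show ?case using D_Rn[OF n] by simp
  next
    case (Suc k)
    have "poly_fun ?n (\<lambda>v. v ! k + (- (c ! k)))"
      by (intro poly_fun.intros) (use Suc in auto)
    then have "{v \<in> {v \<in> Rn ?n. \<forall>i < k. v ! i = c ! i}. v ! k + (- (c ! k)) = 0} \<in> D ?n"
      using Suc n by (intro D_zero_set) auto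
    moreover have "{v \<in> {v \<in> Rn ?n. \<forall>i < k. v ! i = c ! i}. v ! k + (- (c ! k)) = 0} =
        {v \<in> Rn ?n. \<forall>i < Suc k. v ! i = c ! i}"
      by (auto simp: less_Suc_eq)
    ultimately show ?case by simp
  qed
  have "{v \<in> Rn ?n. \<forall>i < ?n. v ! i = c ! i} = {c}"
    by (auto simp: Rn_def intro: nth_equalityI)
  then show ?thesis using prefix[of ?n] by simp
qed

lemma definable_on_const:
  assumes "1 \<le> n" "1 \<le> length c" "A \<in> D n"
  shows "definable_on n (length c) A (\<lambda>_. c)"
proof -
  have "cprod A {c} \<in> D (n + length c)" using assms by (intro product D_singleton) auto
  moreover have "cprod A {c} = (\<lambda>x. x @ c) ` A" by (auto simp: cprod_iff)
  ultimately show ?thesis using assms unfolding definable_on_def by simp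
qed

text \<open>Composition is relational: inside the product of the two graphs, the value of \<open>f\<close> is required to be the
  argument of \<open>g\<close>, and these two blocks of coordinates are then omitted.\<close>

lemma definable_on_comp:
  assumes f: "definable_on n k A f" and g: "definable_on k l B g" and fAB: "f \<in> A \<rightarrow> B"
  shows "definable_on n l A (\<lambda>x. g (f x))"
proof -
  note df = definable_onD[OF f] and dg = definable_onD[OF g]
  let ?P = "cprod ((\<lambda>x. x @ f x) ` A) ((\<lambda>y. y @ g y) ` B)"
  let ?S = "{v \<in> ?P. select [n..<n + k] v = select [n + k..<n + k + k] v}"
  let ?\<sigma> = "[0..<n] @ [n + k + k..<n + k + k + l]"
  have "?P \<in> D ((n + k) + (k + l))" using df dg by (intro product) auto
  then have "?S \<in> D ((n + k) + (k + l))" using df dg by (intro D_coords_eq) auto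
  then have "select ?\<sigma> ` ?S \<in> D (length ?\<sigma>)"
    using df by (intro D_select_image[of "(n + k) + (k + l)"]) auto
  moreover have val: "select [n..<n + k] (x @ f x @ y @ g y) = f x"
      "select [n + k..<n + k + k] (x @ f x @ y @ g y) = y"
      "select ?\<sigma> (x @ f x @ y @ g y) = x @ g y" if "x \<in> A" "y \<in> B" for x y
    using that df dg select_block[of x n "f x" "n + k"] select_block[of "x @ f x" "n + k" y "n + k + k"]
      select_block_end[of "x @ f x @ y" "n + k + k" "g y"] select_block_start[of x n]
    by auto
  have "select ?\<sigma> ` ?S = (\<lambda>x. x @ g (f x)) ` A"
  proof
    show "select ?\<sigma> ` ?S \<subseteq> (\<lambda>x. x @ g (f x)) ` A"
    proof
      fix u assume "u \<in> select ?\<sigma> ` ?S"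
      then obtain x y where xy: "x \<in> A" "y \<in> B" "x @ f x @ y @ g y \<in> ?S"
        "u = select ?\<sigma> (x @ f x @ y @ g y)" by (auto simp: cprod_iff)
      then have "y = f x" using val[OF xy(1,2)] by simp
      then have "u = x @ g (f x)" using xy(4) val(3)[OF xy(1,2)] by simp
      then show "u \<in> (\<lambda>x. x @ g (f x)) ` A" using xy(1) by blast
    qed
    show "(\<lambda>x. x @ g (f x)) ` A \<subseteq> select ?\<sigma> ` ?S"
    proof
      fix u assume "u \<in> (\<lambda>x. x @ g (f x)) ` A"
      then obtain x where x: "x \<in> A" "u = x @ g (f x)" by blast
      have y: "f x \<in> B" using x fAB by blast
      have "x @ f x @ f x @ g (f x) \<in> ?S" using val[OF x(1) y] x y by (auto simp: cprod_iff)
      moreover have "u = select ?\<sigma> (x @ f x @ f x @ g (f x))" using val[OF x(1) y] x by simp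
      ultimately show "u \<in> select ?\<sigma> ` ?S" by blast
    qed
  qed
  ultimately show ?thesis using df dg fAB unfolding definable_on_def by (auto simp: Pi_iff)
qed

lemma definable_on_pair:
  assumes f: "definable_on n k A f" and g: "definable_on n l A g"
  shows "definable_on n (k + l) A (\<lambda>x. f x @ g x)"
proof -
  note df = definable_onD[OF f] and dg = definable_onD[OF g]
  let ?P = "cprod ((\<lambda>x. x @ f x) ` A) ((\<lambda>y. y @ g y) ` A)"
  let ?S = "{v \<in> ?P. select [0..<n] v = select [n + k..<n + k + n] v}"
  let ?\<sigma> = "[0..<n + k] @ [n + k + n..<n + k + n + l]"
  have "?P \<in> D ((n + k) + (n + l))" using df dg by (intro product) auto
  then have "?S \<in> D ((n + k) + (n + l))" using df dg by (intro D_coords_eq) auto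
  then have "select ?\<sigma> ` ?S \<in> D (length ?\<sigma>)"
    using df by (intro D_select_image[of "(n + k) + (n + l)"]) auto
  moreover have val: "select [0..<n] (x @ f x @ y @ g y) = x"
      "select [n + k..<n + k + n] (x @ f x @ y @ g y) = y"
      "select ?\<sigma> (x @ f x @ y @ g y) = x @ f x @ g y" if "x \<in> A" "y \<in> A" for x y
    using that df dg select_block_start[of "x @ f x" "n + k"] select_block[of "x @ f x" "n + k" y "n + k + n"]
      select_block_end[of "x @ f x @ y" "n + k + n" "g y"] select_block_start[of x n]
    by auto
  have "select ?\<sigma> ` ?S = (\<lambda>x. x @ f x @ g x) ` A"
  proof
    show "select ?\<sigma> ` ?S \<subseteq> (\<lambda>x. x @ f x @ g x) ` A"
    proof
      fix u assume "u \<in> select ?\<sigma> ` ?S"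
      then obtain x y where xy: "x \<in> A" "y \<in> A" "x @ f x @ y @ g y \<in> ?S"
        "u = select ?\<sigma> (x @ f x @ y @ g y)" by (auto simp: cprod_iff)
      then have "y = x" using val[OF xy(1,2)] by simp
      then have "u = x @ f x @ g x" using xy(4) val(3)[OF xy(1,2)] by simp
      then show "u \<in> (\<lambda>x. x @ f x @ g x) ` A" using xy(1) by blast
    qed
    show "(\<lambda>x. x @ f x @ g x) ` A \<subseteq> select ?\<sigma> ` ?S"
    proof
      fix u assume "u \<in> (\<lambda>x. x @ f x @ g x) ` A"
      then obtain x where x: "x \<in> A" "u = x @ f x @ g x" by blast
      have "x @ f x @ x @ g x \<in> ?S" using val[OF x(1) x(1)] x by (auto simp: cprod_iff)
      moreover have "u = select ?\<sigma> (x @ f x @ x @ g x)" using val[OF x(1) x(1)] x by simp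
      ultimately show "u \<in> select ?\<sigma> ` ?S" by blast
    qed
  qed
  ultimately show ?thesis using df dg unfolding definable_on_def by (auto simp: add.assoc)
qed

lemma definable_on_image:
  assumes f: "definable_on n k A f"
  shows "f ` A \<in> D k"
proof -
  note df = definable_onD[OF f]
  have "select [n..<n + k] ` (\<lambda>x. x @ f x) ` A \<in> D (length [n..<n + k])"
    using df by (intro D_select_image[of "n + k"]) auto
  moreover have "select [n..<n + k] (x @ f x) = f x" if "x \<in> A" for x
    using that df by (intro select_block_end) auto
  then have "select [n..<n + k] ` (\<lambda>x. x @ f x) ` A = f ` A"
    unfolding image_image by (intro image_cong) auto
  ultimately show ?thesis by simp
qed

lemma definable_on_inverse:
  assumes f: "definable_on n k A f" and inj: "inj_on f A"
  shows "definable_on k n (f ` A) (inv_into A f)"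
proof -
  note df = definable_onD[OF f]
  let ?\<sigma> = "[n..<n + k] @ [0..<n]"
  have "select ?\<sigma> ` (\<lambda>x. x @ f x) ` A \<in> D (length ?\<sigma>)"
    using df by (intro D_select_image[of "n + k"]) auto
  moreover have "select ?\<sigma> (x @ f x) = f x @ x" if "x \<in> A" for x
    using that df by (auto simp: select_block_end select_block_start)
  then have "select ?\<sigma> ` (\<lambda>x. x @ f x) ` A = (\<lambda>y. y @ inv_into A f y) ` f ` A"
    unfolding image_image using inj by (intro image_cong) auto
  ultimately show ?thesis
    using df inj definable_on_image[OF f] unfolding definable_on_def by simp
qed

lemma D_equalizer:
  assumes f: "definable_on n k A f" and g: "definable_on n k A g"
  shows "{x \<in> A. f x = g x} \<in> D n"
proof -
  note df = definable_onD[OF f] and dg = definable_onD[OF g]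
  note dh = definable_onD[OF definable_on_pair[OF f g]]
  let ?S = "{v \<in> (\<lambda>x. x @ f x @ g x) ` A. select [n..<n + k] v = select [n + k..<n + k + k] v}"
  have "?S \<in> D (n + (k + k))" using dh df by (intro D_coords_eq) auto
  then have "take n ` ?S \<in> D n" using df by (intro D_take)
  moreover have val: "select [n..<n + k] (x @ f x @ g x) = f x"
      "select [n + k..<n + k + k] (x @ f x @ g x) = g x" if "x \<in> A" for x
    using that df dg select_block[of x n "f x" "n + k" "g x"]
      select_block_end[of "x @ f x" "n + k" "g x" "n + k + k"] by auto
  have "take n ` ?S = {x \<in> A. f x = g x}"
  proof
    show "take n ` ?S \<subseteq> {x \<in> A. f x = g x}" using val df(5) by auto
    show "{x \<in> A. f x = g x} \<subseteq> take n ` ?S"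
    proof
      fix x assume "x \<in> {x \<in> A. f x = g x}"
      then have x: "x \<in> A" "f x = g x" by auto
      have "select [n..<n + k] (x @ f x @ g x) = select [n + k..<n + k + k] (x @ f x @ g x)"
        using val[OF x(1)] x(2) by simp
      then have "x @ f x @ g x \<in> ?S" using x(1) by (intro CollectI conjI imageI)
      moreover have "x = take n (x @ f x @ g x)" using df(5)[OF x(1)] by simp
      ultimately show "x \<in> take n ` ?S" by blast
    qed
  qed
  ultimately show ?thesis by simp
qed

lemma definable_on_subset:
  assumes f: "definable_on n k A f" and B: "B \<subseteq> A" "B \<in> D n"
  shows "definable_on n k B f"
proof -
  note df = definable_onD[OF f]
  have "(\<lambda>x. x @ f x) ` B = (\<lambda>x. x @ f x) ` A \<inter> cprod B (Rn k)"
    using B df(5,6) by (auto simp: cprod_iff Rn_def)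
  moreover have "(\<lambda>x. x @ f x) ` A \<inter> cprod B (Rn k) \<in> D (n + k)"
    using df B by (intro D_Int product D_Rn) auto
  ultimately show ?thesis using df B unfolding definable_on_def by auto
qed

lemma definable_on_Un:
  assumes "definable_on n k A f" "definable_on n k B f"
  shows "definable_on n k (A \<union> B) f"
proof -
  have "(\<lambda>x. x @ f x) ` (A \<union> B) = (\<lambda>x. x @ f x) ` A \<union> (\<lambda>x. x @ f x) ` B" by (rule image_Un)
  then show ?thesis using assms D_Un unfolding definable_on_def by auto
qed

text \<open>Translation of the arrows of the category of definable sets. If \<open>A\<close> is not empty then the length of a single
  point of the graph determines the dimension in which the graph is definable.\<close>

lemma definable_map_iff:
  assumes "1 \<le> n" "1 \<le> k" "A \<in> D n" "B \<in> D k"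
  shows "definable_map D (A, f, B) \<longleftrightarrow> f \<in> A \<rightarrow>\<^sub>E B \<and> definable_on n k A f"
proof -
  have graph: "definable D {x @ f x | x. x \<in> A} \<longleftrightarrow> (\<lambda>x. x @ f x) ` A \<in> D (n + k)"
    if f: "f \<in> A \<rightarrow>\<^sub>E B"
  proof
    assume "definable D {x @ f x | x. x \<in> A}"
    then obtain l where l: "1 \<le> l" "(\<lambda>x. x @ f x) ` A \<in> D l"
      unfolding definable_def Setcompr_eq_image by blast
    show "(\<lambda>x. x @ f x) ` A \<in> D (n + k)"
    proof (cases "A = {}")
      case True
      then show ?thesis using assms D_empty by simp
    next
      case False
      then obtain x where x: "x \<in> A" by blast
      then have "length (x @ f x) = l" using D_length l by blast
      moreover have "length (x @ f x) = n + k"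
        using D_length[OF assms(1,3) x] D_length[OF assms(2,4)] x f by auto
      ultimately show ?thesis using l by simp
    qed
  next
    assume "(\<lambda>x. x @ f x) ` A \<in> D (n + k)"
    then show "definable D {x @ f x | x. x \<in> A}"
      using assms unfolding definable_def Setcompr_eq_image by (intro exI[of _ "n + k"]) auto
  qed
  have "\<forall>x \<in> A. length (f x) = k" if "f \<in> A \<rightarrow>\<^sub>E B"
    using that D_length[OF assms(2,4)] by auto
  then show ?thesis
    using assms graph unfolding definable_map_def definable_on_def definable_def
    by auto
qed

end

section \<open>Mealy machines as a concrete category\<close>

definition mealy :: "real list set \<Rightarrow> real list set \<Rightarrow> real list set \<Rightarrow> (real list \<Rightarrow> real list) \<Rightarrow>
    real list set \<times> def_arr" where
  "mealy I J S a = (S, (cprod S I, a, cprod S J))"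

text \<open>Equality of \<open>(\<phi> \<times> id) \<circ> a\<close> and \<open>a' \<circ> (\<phi> \<times> id)\<close>, stated through decompositions \<open>a (s @ x) = t @ y\<close>, so that no
  projections out of a product are mentioned. When both machines are over definable sets such a
  decomposition exists and is unique.\<close>

definition machine_map :: "real list set \<Rightarrow> real list set \<Rightarrow> real list set \<Rightarrow> (real list \<Rightarrow> real list) \<Rightarrow>
    (real list \<Rightarrow> real list) \<Rightarrow> (real list \<Rightarrow> real list) \<Rightarrow> bool" where
  "machine_map I J S a a' \<phi> \<longleftrightarrow>
     (\<forall>s \<in> S. \<forall>x \<in> I. \<forall>t \<in> S. \<forall>y \<in> J. a (s @ x) = t @ y \<longrightarrow> a' (\<phi> s @ x) = \<phi> t @ y)"

definition underlying :: "(real list set \<times> def_arr) \<times> def_arr \<times> (real list set \<times> def_arr) \<Rightarrow>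
    real list \<Rightarrow> real list" where
  "underlying F = fst (snd (fst (snd F)))"

lemma cprodI: "x \<in> A \<Longrightarrow> y \<in> B \<Longrightarrow> x @ y \<in> cprod A B"
  by (auto simp: cprod_iff)

lemma cprodE:
  assumes "z \<in> cprod A B"
  obtains x y where "x \<in> A" "y \<in> B" "z = x @ y"
  using assms by (auto simp: cprod_iff)

lemma machine_mapD:
  "\<lbrakk>machine_map I J S a a' \<phi>; s \<in> S; x \<in> I; t \<in> S; y \<in> J; a (s @ x) = t @ y\<rbrakk>
     \<Longrightarrow> a' (\<phi> s @ x) = \<phi> t @ y"
  unfolding machine_map_def by simp

locale definable_interface = o_minimal +
  fixes I J :: "real list set" and i j :: nat
  assumes i: "1 \<le> i" and j: "1 \<le> j" and I: "I \<in> D i" and J: "J \<in> D j"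
begin

abbreviation "Sys \<equiv> SysHo (DefCat D) I J"

definition machine :: "nat \<Rightarrow> real list set \<Rightarrow> (real list \<Rightarrow> real list) \<Rightarrow> bool" where
  "machine n S a \<longleftrightarrow> 1 \<le> n \<and> S \<in> D n \<and> a \<in> cprod S I \<rightarrow>\<^sub>E cprod S J \<and>
     definable_on (n + i) (n + j) (cprod S I) a"

lemma machineD:
  assumes "machine n S a"
  shows "1 \<le> n" "S \<in> D n" "a \<in> cprod S I \<rightarrow>\<^sub>E cprod S J" "definable_on (n + i) (n + j) (cprod S I) a"
  using assms unfolding machine_def by auto

lemma machine_step:
  assumes "machine n S a" "s \<in> S" "x \<in> I"
  obtains t y where "t \<in> S" "y \<in> J" "a (s @ x) = t @ y"
proof -
  have "a (s @ x) \<in> cprod S J" using machineD(3)[OF assms(1)] cprodI[OF assms(2,3)] by blast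
  then show ?thesis using that by (auto elim: cprodE)
qed

text \<open>All points of a definable set have the same length.\<close>

lemma split_unique:
  assumes "1 \<le> n" "S \<in> D n" "s \<in> S" "t \<in> S" "s @ x = t @ y"
  shows "s = t \<and> x = y"
  using assms D_length by (metis append_eq_append_conv)

lemma Hom_DefCat: "\<alpha> \<in> Hom (DefCat D) A B \<longleftrightarrow> (\<exists>f. \<alpha> = (A, f, B) \<and> definable_map D (A, f, B))"
  unfolding Hom_def DefCat_def by (cases \<alpha>) auto

lemma Obj_iff: "M \<in> Obj Sys \<longleftrightarrow> (\<exists>n S a. M = mealy I J S a \<and> machine n S a)"
proof -
  obtain S \<alpha> where M: "M = (S, \<alpha>)" by (cases M)
  have "M \<in> Obj Sys \<longleftrightarrow> definable D S \<and>
      (\<exists>a. \<alpha> = (cprod S I, a, cprod S J) \<and> definable_map D (cprod S I, a, cprod S J))"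
    using M by (simp add: SysHo_def mealy_ho_def Hom_DefCat) (simp add: DefCat_def)
  also have "\<dots> \<longleftrightarrow> (\<exists>n a. \<alpha> = (cprod S I, a, cprod S J) \<and> 1 \<le> n \<and> S \<in> D n \<and>
      definable_map D (cprod S I, a, cprod S J))"
    unfolding definable_def by blast
  also have "\<dots> \<longleftrightarrow> (\<exists>n a. \<alpha> = (cprod S I, a, cprod S J) \<and> machine n S a)"
  proof -
    have "definable_map D (cprod S I, a, cprod S J) \<longleftrightarrow> a \<in> cprod S I \<rightarrow>\<^sub>E cprod S J \<and>
        definable_on (n + i) (n + j) (cprod S I) a" if "1 \<le> n" "S \<in> D n" for n a
      using that i j I J by (intro definable_map_iff product) auto
    then show ?thesis unfolding machine_def by blast
  qed
  finally show ?thesis using M unfolding mealy_def by auto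
qed

lemma ProdArr_apply:
  assumes "1 \<le> n" "S \<in> D n" "s \<in> S" "y \<in> K"
  shows "fst (snd (ProdArr (DefCat D) (S, \<phi>, S') (Ide (DefCat D) K))) (s @ y) = \<phi> s @ y"
proof -
  have "(THE w. \<exists>xs \<in> S. \<exists>ys \<in> K. s @ y = xs @ ys \<and> w = \<phi> xs @ restrict (\<lambda>xs. xs) K ys) = \<phi> s @ y"
  proof (rule the_equality)
    show "\<exists>xs \<in> S. \<exists>ys \<in> K. s @ y = xs @ ys \<and> \<phi> s @ y = \<phi> xs @ restrict (\<lambda>xs. xs) K ys"
      by (rule bexI[OF _ assms(3)], rule bexI[OF _ assms(4)]) (simp add: assms(4))
    fix w assume "\<exists>xs \<in> S. \<exists>ys \<in> K. s @ y = xs @ ys \<and> w = \<phi> xs @ restrict (\<lambda>xs. xs) K ys"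
    then obtain xs ys where w: "xs \<in> S" "ys \<in> K" "s @ y = xs @ ys" "w = \<phi> xs @ restrict (\<lambda>xs. xs) K ys"
      by blast
    with split_unique[OF assms(1,2,3) w(1,3)] show "w = \<phi> s @ y" by simp
  qed
  then show ?thesis using cprodI[OF assms(3,4)] by (simp add: DefCat_def)
qed

lemma ProdArr_ends:
  "ProdArr (DefCat D) (S, \<phi>, S') (Ide (DefCat D) K) =
     (cprod S K, fst (snd (ProdArr (DefCat D) (S, \<phi>, S') (Ide (DefCat D) K))), cprod S' K)"
  by (simp add: DefCat_def)

text \<open>Both sides of the defining equation of a morphism of machines are extensional functions on \<open>cprod S I\<close>, so
  the equation can be checked at the points \<open>s @ x\<close>.\<close>

lemma machine_map_iff:
  assumes S: "machine n S a" and S': "machine n' S' a'" and \<phi>: "\<phi> \<in> S \<rightarrow> S'"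
  shows "ProdArr (DefCat D) (S, \<phi>, S') (Ide (DefCat D) J) \<cdot>\<^bsub>DefCat D\<^esub> (cprod S I, a, cprod S J) =
      (cprod S' I, a', cprod S' J) \<cdot>\<^bsub>DefCat D\<^esub> ProdArr (DefCat D) (S, \<phi>, S') (Ide (DefCat D) I) \<longleftrightarrow>
    machine_map I J S a a' \<phi>"
proof -
  define P where "P K = fst (snd (ProdArr (DefCat D) (S, \<phi>, S') (Ide (DefCat D) K)))" for K
  have P: "P K (s @ y) = \<phi> s @ y" if "s \<in> S" "y \<in> K" for K s y
    unfolding P_def by (rule ProdArr_apply[OF machineD(1,2)[OF S] that])
  have ends: "ProdArr (DefCat D) (S, \<phi>, S') (Ide (DefCat D) K) = (cprod S K, P K, cprod S' K)" for K
    unfolding P_def by (rule ProdArr_ends)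
  have "ProdArr (DefCat D) (S, \<phi>, S') (Ide (DefCat D) J) \<cdot>\<^bsub>DefCat D\<^esub> (cprod S I, a, cprod S J) =
      (cprod S' I, a', cprod S' J) \<cdot>\<^bsub>DefCat D\<^esub> ProdArr (DefCat D) (S, \<phi>, S') (Ide (DefCat D) I) \<longleftrightarrow>
      compose (cprod S I) (P J) a = compose (cprod S I) a' (P I)"
    unfolding ends by (simp add: DefCat_def)
  also have "\<dots> \<longleftrightarrow> (\<forall>z \<in> cprod S I. P J (a z) = a' (P I z))"
    by (auto simp: compose_def restrict_def fun_eq_iff)
  also have "\<dots> \<longleftrightarrow> (\<forall>s \<in> S. \<forall>x \<in> I. P J (a (s @ x)) = a' (P I (s @ x)))"
    unfolding cprod_iff Ball_def by blast
  also have "\<dots> \<longleftrightarrow> (\<forall>s \<in> S. \<forall>x \<in> I. P J (a (s @ x)) = a' (\<phi> s @ x))"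
    using P by simp
  also have "\<dots> \<longleftrightarrow> machine_map I J S a a' \<phi>"
    unfolding machine_map_def
  proof (intro ball_cong refl)
    fix s x assume sx: "s \<in> S" "x \<in> I"
    obtain t y where ty: "t \<in> S" "y \<in> J" "a (s @ x) = t @ y" using machine_step[OF S sx] .
    show "P J (a (s @ x)) = a' (\<phi> s @ x) \<longleftrightarrow>
        (\<forall>t \<in> S. \<forall>y \<in> J. a (s @ x) = t @ y \<longrightarrow> a' (\<phi> s @ x) = \<phi> t @ y)"
    proof
      assume "P J (a (s @ x)) = a' (\<phi> s @ x)"
      then show "\<forall>t \<in> S. \<forall>y \<in> J. a (s @ x) = t @ y \<longrightarrow> a' (\<phi> s @ x) = \<phi> t @ y"
        using P by (metis)
    next
      assume "\<forall>t \<in> S. \<forall>y \<in> J. a (s @ x) = t @ y \<longrightarrow> a' (\<phi> s @ x) = \<phi> t @ y"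
      then have "a' (\<phi> s @ x) = \<phi> t @ y" using ty by simp
      then show "P J (a (s @ x)) = a' (\<phi> s @ x)" using ty P by simp
    qed
  qed
  finally show ?thesis .
qed

lemma Hom_Sys: "F \<in> Hom Sys M N \<longleftrightarrow> F \<in> Arr Sys \<and> Dom Sys F = M \<and> Cod Sys F = N"
  by (simp add: Hom_def)

lemma Hom_iff:
  assumes S: "machine n S a" and S': "machine n' S' a'"
  shows "F \<in> Hom Sys (mealy I J S a) (mealy I J S' a') \<longleftrightarrow>
    (\<exists>\<phi>. F = (mealy I J S a, (S, \<phi>, S'), mealy I J S' a') \<and> \<phi> \<in> S \<rightarrow>\<^sub>E S' \<and>
      definable_on n n' S \<phi> \<and> machine_map I J S a a' \<phi>)"
proof -
  have obj: "mealy I J S a \<in> mealy_ho (DefCat D) I J" "mealy I J S' a' \<in> mealy_ho (DefCat D) I J"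
    using Obj_iff S S' unfolding SysHo_def by auto
  have "F \<in> Hom Sys (mealy I J S a) (mealy I J S' a') \<longleftrightarrow>
    (\<exists>\<phi>. F = (mealy I J S a, (S, \<phi>, S'), mealy I J S' a') \<and> definable_map D (S, \<phi>, S') \<and>
      ProdArr (DefCat D) (S, \<phi>, S') (Ide (DefCat D) J) \<cdot>\<^bsub>DefCat D\<^esub> (cprod S I, a, cprod S J) =
      (cprod S' I, a', cprod S' J) \<cdot>\<^bsub>DefCat D\<^esub> ProdArr (DefCat D) (S, \<phi>, S') (Ide (DefCat D) I))"
    unfolding Hom_Sys by (cases F) (use obj in \<open>auto simp: SysHo_def mealy_def Hom_DefCat\<close>)
  also have "\<dots> \<longleftrightarrow> (\<exists>\<phi>. F = (mealy I J S a, (S, \<phi>, S'), mealy I J S' a') \<and>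
      (\<phi> \<in> S \<rightarrow>\<^sub>E S' \<and> definable_on n n' S \<phi>) \<and> machine_map I J S a a' \<phi>)"
  proof -
    have "definable_map D (S, \<phi>, S') \<longleftrightarrow> \<phi> \<in> S \<rightarrow>\<^sub>E S' \<and> definable_on n n' S \<phi>" for \<phi>
      using machineD[OF S] machineD[OF S'] by (intro definable_map_iff)
    moreover have "\<phi> \<in> S \<rightarrow> S'" if "\<phi> \<in> S \<rightarrow>\<^sub>E S'" for \<phi> using that by blast
    ultimately show ?thesis using machine_map_iff[OF S S'] by auto
  qed
  finally show ?thesis by simp
qed

lemma HomD_machine:
  assumes S: "machine n S a" and S': "machine n' S' a'"
    and F: "F \<in> Hom Sys (mealy I J S a) (mealy I J S' a')"
  shows "F = (mealy I J S a, (S, underlying F, S'), mealy I J S' a')" "underlying F \<in> S \<rightarrow>\<^sub>E S'"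
    "definable_on n n' S (underlying F)" "machine_map I J S a a' (underlying F)"
  using F unfolding Hom_iff[OF S S'] underlying_def by auto

lemma HomI_machine:
  assumes S: "machine n S a" and S': "machine n' S' a'"
    and h: "definable_on n n' S h" "h \<in> S \<rightarrow> S'" "machine_map I J S a a' h"
  shows "\<exists>k \<in> Hom Sys (mealy I J S a) (mealy I J S' a'). \<forall>s \<in> S. underlying k s = h s"
proof
  let ?k = "(mealy I J S a, (S, restrict h S, S'), mealy I J S' a')"
  show "\<forall>s \<in> S. underlying ?k s = h s" by (simp add: underlying_def)
  have "definable_on n n' S (restrict h S)" by (rule definable_on_cong[OF h(1)]) simp
  moreover have "machine_map I J S a a' (restrict h S)"
    using h(3) unfolding machine_map_def by simp
  ultimately show "?k \<in> Hom Sys (mealy I J S a) (mealy I J S' a')"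
    unfolding Hom_iff[OF S S'] using h(2) by auto
qed

lemma Hom_Obj_Sys: "F \<in> Hom Sys M N \<Longrightarrow> M \<in> Obj Sys \<and> N \<in> Obj Sys"
  unfolding Hom_Sys by (auto simp: SysHo_def)

lemma ObjE:
  assumes "M \<in> Obj Sys"
  obtains n S a where "M = mealy I J S a" "machine n S a"
  using assms Obj_iff by blast

lemma Ide_Sys:
  assumes "machine n S a"
  shows "Ide Sys (mealy I J S a) = (mealy I J S a, (S, \<lambda>x \<in> S. x, S), mealy I J S a)"
  by (simp add: SysHo_def mealy_def DefCat_def)

lemma Cmp_Sys:
  "(M', (S', \<psi>, S''), M'') \<cdot>\<^bsub>Sys\<^esub> (M, (S, \<phi>, S'), M') = (M, (S, compose S \<psi> \<phi>, S''), M'')"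
  by (simp add: SysHo_def DefCat_def)

lemma Ide_Sys_Hom:
  assumes "machine n S a"
  shows "Ide Sys (mealy I J S a) \<in> Hom Sys (mealy I J S a) (mealy I J S a)"
proof -
  have "definable_on n n S (\<lambda>x \<in> S. x)"
    using machineD[OF assms] by (intro definable_on_cong[OF definable_on_id]) auto
  moreover have "machine_map I J S a a (\<lambda>x \<in> S. x)" by (simp add: machine_map_def)
  ultimately show ?thesis unfolding Hom_iff[OF assms assms] Ide_Sys[OF assms] by auto
qed

lemma Cmp_Sys_Hom:
  assumes S: "machine n S a" and S': "machine n' S' a'" and S'': "machine n'' S'' a''"
    and F: "F \<in> Hom Sys (mealy I J S a) (mealy I J S' a')"
    and G: "G \<in> Hom Sys (mealy I J S' a') (mealy I J S'' a'')"
  shows "G \<cdot>\<^bsub>Sys\<^esub> F =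
      (mealy I J S a, (S, compose S (underlying G) (underlying F), S''), mealy I J S'' a'')"
    and "G \<cdot>\<^bsub>Sys\<^esub> F \<in> Hom Sys (mealy I J S a) (mealy I J S'' a'')"
proof -
  note f = HomD_machine[OF S S' F] and g = HomD_machine[OF S' S'' G]
  show eq: "G \<cdot>\<^bsub>Sys\<^esub> F =
      (mealy I J S a, (S, compose S (underlying G) (underlying F), S''), mealy I J S'' a'')"
    by (subst f(1), subst g(1), rule Cmp_Sys)
  have fS: "underlying F \<in> S \<rightarrow> S'" and gS: "underlying G \<in> S' \<rightarrow> S''" using f(2) g(2) by blast+
  have "definable_on n n'' S (compose S (underlying G) (underlying F))"
    by (rule definable_on_cong[OF definable_on_comp[OF f(3) g(3) fS]]) (simp add: compose_def)
  moreover have "compose S (underlying G) (underlying F) \<in> S \<rightarrow>\<^sub>E S''"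
    using fS gS by (auto simp: compose_def)
  moreover have "machine_map I J S a a'' (compose S (underlying G) (underlying F))"
    unfolding machine_map_def
  proof (intro ballI impI)
    fix s x t y assume *: "s \<in> S" "x \<in> I" "t \<in> S" "y \<in> J" "a (s @ x) = t @ y"
    have "a' (underlying F s @ x) = underlying F t @ y" by (rule machine_mapD[OF f(4) *])
    then have "a'' (underlying G (underlying F s) @ x) = underlying G (underlying F t) @ y"
      using * fS by (intro machine_mapD[OF g(4)]) auto
    then show "a'' (compose S (underlying G) (underlying F) s @ x) = compose S (underlying G) (underlying F) t @ y"
      using * by (simp add: compose_def)
  qed
  ultimately show "G \<cdot>\<^bsub>Sys\<^esub> F \<in> Hom Sys (mealy I J S a) (mealy I J S'' a'')"
    unfolding eq Hom_iff[OF S S''] by auto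
qed

lemma underlying_Cmp:
  assumes F: "F \<in> Hom Sys M N" and G: "G \<in> Hom Sys N K" and x: "x \<in> fst M"
  shows "underlying (G \<cdot>\<^bsub>Sys\<^esub> F) x = underlying G (underlying F x)"
proof -
  obtain n S a where S: "M = mealy I J S a" "machine n S a" using Hom_Obj_Sys[OF F] ObjE by blast
  obtain n' S' a' where S': "N = mealy I J S' a'" "machine n' S' a'" using Hom_Obj_Sys[OF F] ObjE by blast
  obtain n'' S'' a'' where S'': "K = mealy I J S'' a''" "machine n'' S'' a''" using Hom_Obj_Sys[OF G] ObjE by blast
  have "x \<in> S" using x S by (simp add: mealy_def)
  then show ?thesis
    using Cmp_Sys_Hom(1)[OF S(2) S'(2) S''(2)] F G S S' S'' by (simp add: underlying_def[of "(_, _, _)"] compose_def)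
qed

lemma underlying_funcset:
  assumes F: "F \<in> Hom Sys M N"
  shows "underlying F \<in> fst M \<rightarrow> fst N"
proof -
  obtain n S a where S: "M = mealy I J S a" "machine n S a" using Hom_Obj_Sys[OF F] ObjE by blast
  obtain n' S' a' where S': "N = mealy I J S' a'" "machine n' S' a'" using Hom_Obj_Sys[OF F] ObjE by blast
  have "underlying F \<in> S \<rightarrow>\<^sub>E S'" using HomD_machine(2)[OF S(2) S'(2)] F S S' by simp
  then have "underlying F \<in> S \<rightarrow> S'" by blast
  then show ?thesis using S S' by (simp add: mealy_def)
qed

lemma underlying_faithful:
  assumes F: "F \<in> Hom Sys M N" and G: "G \<in> Hom Sys M N"
    and eq: "\<And>x. x \<in> fst M \<Longrightarrow> underlying F x = underlying G x"
  shows "F = G"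
proof -
  obtain n S a where S: "M = mealy I J S a" "machine n S a" using Hom_Obj_Sys[OF F] ObjE by blast
  obtain n' S' a' where S': "N = mealy I J S' a'" "machine n' S' a'" using Hom_Obj_Sys[OF F] ObjE by blast
  note f = HomD_machine[OF S(2) S'(2) F[unfolded S(1) S'(1)]]
  note g = HomD_machine[OF S(2) S'(2) G[unfolded S(1) S'(1)]]
  have "underlying F = underlying G"
    by (rule PiE_ext[OF f(2) g(2)]) (use eq S in \<open>simp add: mealy_def\<close>)
  then show ?thesis using f(1) g(1) by simp
qed

lemma Ide_Sys_in_Hom: "M \<in> Obj Sys \<Longrightarrow> Ide Sys M \<in> Hom Sys M M"
  using Ide_Sys_Hom ObjE by metis

lemma underlying_Ide:
  assumes "M \<in> Obj Sys" "x \<in> fst M"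
  shows "underlying (Ide Sys M) x = x"
proof -
  obtain n S a where S: "M = mealy I J S a" "machine n S a" using assms(1) ObjE by blast
  then show ?thesis using assms(2) Ide_Sys[OF S(2)] by (simp add: underlying_def mealy_def)
qed

lemma Cmp_Sys_in_Hom:
  assumes F: "F \<in> Hom Sys M N" and G: "G \<in> Hom Sys N K"
  shows "G \<cdot>\<^bsub>Sys\<^esub> F \<in> Hom Sys M K"
proof -
  obtain n S a where S: "M = mealy I J S a" "machine n S a" using Hom_Obj_Sys[OF F] ObjE by blast
  obtain n' S' a' where S': "N = mealy I J S' a'" "machine n' S' a'" using Hom_Obj_Sys[OF F] ObjE by blast
  obtain n'' S'' a'' where S'': "K = mealy I J S'' a''" "machine n'' S'' a''" using Hom_Obj_Sys[OF G] ObjE by blast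
  show ?thesis using Cmp_Sys_Hom(2)[OF S(2) S'(2) S''(2)] F G S S' S'' by simp
qed

lemma category_Sys: "category Sys"
proof
  show "Dom Sys f \<in> Obj Sys" "Cod Sys f \<in> Obj Sys" if "f \<in> Arr Sys" for f
    using that unfolding SysHo_def by auto
  show "Ide Sys A \<in> Hom Sys A A" if "A \<in> Obj Sys" for A by (rule Ide_Sys_in_Hom[OF that])
  show "g \<cdot>\<^bsub>Sys\<^esub> f \<in> Hom Sys X Z" if "f \<in> Hom Sys X Y" "g \<in> Hom Sys Y Z" for f g X Y Z
    by (rule Cmp_Sys_in_Hom[OF that])
  show "f \<cdot>\<^bsub>Sys\<^esub> Ide Sys X = f" "Ide Sys Y \<cdot>\<^bsub>Sys\<^esub> f = f" if f: "f \<in> Hom Sys X Y" for f X Y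
  proof -
    have X: "Ide Sys X \<in> Hom Sys X X" and Y: "Ide Sys Y \<in> Hom Sys Y Y"
      using Hom_Obj_Sys[OF f] Ide_Sys_in_Hom by auto
    show "f \<cdot>\<^bsub>Sys\<^esub> Ide Sys X = f"
      by (rule underlying_faithful[OF Cmp_Sys_in_Hom[OF X f] f])
        (simp add: underlying_Cmp[OF X f] underlying_Ide Hom_Obj_Sys[OF f])
    show "Ide Sys Y \<cdot>\<^bsub>Sys\<^esub> f = f"
      by (rule underlying_faithful[OF Cmp_Sys_in_Hom[OF f Y] f])
        (use underlying_funcset[OF f] in \<open>simp add: underlying_Cmp[OF f Y] underlying_Ide Hom_Obj_Sys[OF f] Pi_iff\<close>)
  qed
  show "(h \<cdot>\<^bsub>Sys\<^esub> g) \<cdot>\<^bsub>Sys\<^esub> f = h \<cdot>\<^bsub>Sys\<^esub> (g \<cdot>\<^bsub>Sys\<^esub> f)"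
    if f: "f \<in> Hom Sys W X" and g: "g \<in> Hom Sys X Y" and h: "h \<in> Hom Sys Y Z" for f g h W X Y Z
  proof (rule underlying_faithful)
    note gf = Cmp_Sys_in_Hom[OF f g] and hg = Cmp_Sys_in_Hom[OF g h]
    show "(h \<cdot>\<^bsub>Sys\<^esub> g) \<cdot>\<^bsub>Sys\<^esub> f \<in> Hom Sys W Z" by (rule Cmp_Sys_in_Hom[OF f hg])
    show "h \<cdot>\<^bsub>Sys\<^esub> (g \<cdot>\<^bsub>Sys\<^esub> f) \<in> Hom Sys W Z" by (rule Cmp_Sys_in_Hom[OF gf h])
    fix x assume x: "x \<in> fst W"
    then have "underlying f x \<in> fst X" using underlying_funcset[OF f] by blast
    then show "underlying ((h \<cdot>\<^bsub>Sys\<^esub> g) \<cdot>\<^bsub>Sys\<^esub> f) x = underlying (h \<cdot>\<^bsub>Sys\<^esub> (g \<cdot>\<^bsub>Sys\<^esub> f)) x"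
      by (simp add: underlying_Cmp[OF f hg x] underlying_Cmp[OF gf h x] underlying_Cmp[OF f g x]
          underlying_Cmp[OF g h])
  qed
qed

end

section \<open>Pullbacks and gluings of machines\<close>

context definable_interface
begin

lemma underlying_in:
  assumes "machine n S a" "machine n' S' a'" "F \<in> Hom Sys (mealy I J S a) (mealy I J S' a')" "s \<in> S"
  shows "underlying F s \<in> S'"
  using HomD_machine(2)[OF assms(1-3)] assms(4) by blast

lemma Hom_step:
  assumes "machine n S a" "machine n' S' a'" "F \<in> Hom Sys (mealy I J S a) (mealy I J S' a')"
    "s \<in> S" "x \<in> I" "t \<in> S" "y \<in> J" "a (s @ x) = t @ y"
  shows "a' (underlying F s @ x) = underlying F t @ y"
  by (rule machine_mapD[OF HomD_machine(4)[OF assms(1-3)] assms(4-8)])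

text \<open>With \<open>(f, g)\<close> injective, \<open>h\<close> is \<open>(f, g)\<close> inverted after \<open>(f', g')\<close>, hence definable. It commutes with the
  steps because \<open>f\<close> and \<open>g\<close> both do and together separate the states of \<open>P\<close>.\<close>

lemma cone_lift_Sys:
  assumes f: "f \<in> Hom Sys P X" and g: "g \<in> Hom Sys P Y" and f': "f' \<in> Hom Sys T X" and g': "g' \<in> Hom Sys T Y"
    and joint: "\<And>s t. \<lbrakk>s \<in> fst P; t \<in> fst P; underlying f s = underlying f t;
      underlying g s = underlying g t\<rbrakk> \<Longrightarrow> s = t"
    and h: "\<And>t. t \<in> fst T \<Longrightarrow> h t \<in> fst P \<and> underlying f (h t) = underlying f' t \<and>
      underlying g (h t) = underlying g' t"
  shows "\<exists>k \<in> Hom Sys T P. \<forall>t \<in> fst T. underlying k t = h t"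
proof -
  obtain p SP aP where P: "P = mealy I J SP aP" and mP: "machine p SP aP"
    using Hom_Obj_Sys[OF f] ObjE by blast
  obtain x SX aX where X: "X = mealy I J SX aX" and mX: "machine x SX aX"
    using Hom_Obj_Sys[OF f] ObjE by blast
  obtain y SY aY where Y: "Y = mealy I J SY aY" and mY: "machine y SY aY"
    using Hom_Obj_Sys[OF g] ObjE by blast
  obtain t ST aT where T: "T = mealy I J ST aT" and mT: "machine t ST aT"
    using Hom_Obj_Sys[OF f'] ObjE by blast
  note f = f[unfolded P X] and g = g[unfolded P Y] and f' = f'[unfolded T X] and g' = g'[unfolded T Y]
  have joint: "s = s'" if "s \<in> SP" "s' \<in> SP" "underlying f s = underlying f s'"
    "underlying g s = underlying g s'" for s s'
    using joint[of s s'] that by (simp add: P mealy_def)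
  have h: "h s \<in> SP" "underlying f (h s) = underlying f' s" "underlying g (h s) = underlying g' s"
    if "s \<in> ST" for s
    using h[of s] that by (auto simp: P T mealy_def)
  let ?fg = "\<lambda>s. underlying f s @ underlying g s" and ?fg' = "\<lambda>s. underlying f' s @ underlying g' s"
  have fg: "definable_on p (x + y) SP ?fg"
    by (rule definable_on_pair[OF HomD_machine(3)[OF mP mX f] HomD_machine(3)[OF mP mY g]])
  have fg': "definable_on t (x + y) ST ?fg'"
    by (rule definable_on_pair[OF HomD_machine(3)[OF mT mX f'] HomD_machine(3)[OF mT mY g']])
  have inj: "inj_on ?fg SP"
  proof (rule inj_onI)
    fix s s' assume s: "s \<in> SP" "s' \<in> SP" "?fg s = ?fg s'"
    have "underlying f s = underlying f s' \<and> underlying g s = underlying g s'"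
      by (rule split_unique[OF machineD(1,2)[OF mX] underlying_in[OF mP mX f s(1)]
            underlying_in[OF mP mX f s(2)] s(3)])
    then show "s = s'" using joint s by blast
  qed
  have fg'_h: "?fg' s = ?fg (h s)" if "s \<in> ST" for s using h[OF that] by simp
  have "?fg' \<in> ST \<rightarrow> ?fg ` SP"
  proof
    fix s assume s: "s \<in> ST"
    show "?fg' s \<in> ?fg ` SP" unfolding fg'_h[OF s] using h(1)[OF s] by (rule imageI)
  qed
  then have "definable_on t p ST (\<lambda>s. inv_into SP ?fg (?fg' s))"
    by (rule definable_on_comp[OF fg' definable_on_inverse[OF fg inj]])
  then have "definable_on t p ST h"
  proof (rule definable_on_cong)
    fix s assume s: "s \<in> ST"
    show "inv_into SP ?fg (?fg' s) = h s" unfolding fg'_h[OF s] by (rule inv_into_f_f[OF inj h(1)[OF s]])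
  qed
  moreover have "h \<in> ST \<rightarrow> SP" using h(1) by blast
  moreover have "machine_map I J ST aT aP h"
    unfolding machine_map_def
  proof (intro ballI impI)
    fix s u s' v assume s: "s \<in> ST" and u: "u \<in> I" and s': "s' \<in> ST" and v: "v \<in> J"
      and step: "aT (s @ u) = s' @ v"
    obtain r w where r: "r \<in> SP" and w: "w \<in> J" and stepP: "aP (h s @ u) = r @ w"
      by (rule machine_step[OF mP h(1)[OF s] u])
    have "underlying f r @ w = underlying f (h s') @ v"
      using Hom_step[OF mP mX f h(1)[OF s] u r w stepP] Hom_step[OF mT mX f' s u s' v step]
      by (simp add: h[OF s] h[OF s'])
    then have fr: "underlying f r = underlying f (h s') \<and> w = v"
      by (rule split_unique[OF machineD(1,2)[OF mX] underlying_in[OF mP mX f r]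
            underlying_in[OF mP mX f h(1)[OF s']]])
    have "underlying g r @ w = underlying g (h s') @ v"
      using Hom_step[OF mP mY g h(1)[OF s] u r w stepP] Hom_step[OF mT mY g' s u s' v step]
      by (simp add: h[OF s] h[OF s'])
    then have gr: "underlying g r = underlying g (h s') \<and> w = v"
      by (rule split_unique[OF machineD(1,2)[OF mY] underlying_in[OF mP mY g r]
            underlying_in[OF mP mY g h(1)[OF s']]])
    have "r = h s'" using joint[OF r h(1)[OF s']] fr gr by simp
    then show "aP (h s @ u) = h s' @ v" using stepP fr by simp
  qed
  ultimately show ?thesis
    using HomI_machine[OF mT mP] by (simp add: P T) (simp add: mealy_def)
qed

text \<open>The graph of \<open>h\<close> is the union of the images of \<open>X\<close> under \<open>(g, g')\<close> and of \<open>Y\<close> under \<open>(n, n')\<close>, hence definable.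
  Each state of \<open>Z\<close> is the image of a state of \<open>X\<close> or \<open>Y\<close>, whose steps both \<open>Z\<close> and \<open>T\<close> follow.\<close>

lemma cocone_lift_Sys:
  assumes g: "g \<in> Hom Sys X Z" and n: "n \<in> Hom Sys Y Z" and g': "g' \<in> Hom Sys X T" and n': "n' \<in> Hom Sys Y T"
    and cover: "fst Z \<subseteq> underlying g ` fst X \<union> underlying n ` fst Y"
    and hg: "\<And>s. s \<in> fst X \<Longrightarrow> h (underlying g s) = underlying g' s"
    and hn: "\<And>s. s \<in> fst Y \<Longrightarrow> h (underlying n s) = underlying n' s"
  shows "\<exists>k \<in> Hom Sys Z T. \<forall>t \<in> fst Z. underlying k t = h t"
proof -
  obtain z SZ aZ where Z: "Z = mealy I J SZ aZ" and mZ: "machine z SZ aZ"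
    using Hom_Obj_Sys[OF g] ObjE by blast
  obtain x SX aX where X: "X = mealy I J SX aX" and mX: "machine x SX aX"
    using Hom_Obj_Sys[OF g] ObjE by blast
  obtain y SY aY where Y: "Y = mealy I J SY aY" and mY: "machine y SY aY"
    using Hom_Obj_Sys[OF n] ObjE by blast
  obtain t ST aT where T: "T = mealy I J ST aT" and mT: "machine t ST aT"
    using Hom_Obj_Sys[OF g'] ObjE by blast
  note g = g[unfolded X Z] and n = n[unfolded Y Z] and g' = g'[unfolded X T] and n' = n'[unfolded Y T]
  have hg: "h (underlying g s) = underlying g' s" if "s \<in> SX" for s
    using hg[of s] that by (simp add: X mealy_def)
  have hn: "h (underlying n s) = underlying n' s" if "s \<in> SY" for s
    using hn[of s] that by (simp add: Y mealy_def)
  have SZ: "SZ = underlying g ` SX \<union> underlying n ` SY"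
  proof
    show "SZ \<subseteq> underlying g ` SX \<union> underlying n ` SY" using cover by (simp add: X Y Z mealy_def)
    show "underlying g ` SX \<union> underlying n ` SY \<subseteq> SZ"
      using underlying_in[OF mX mZ g] underlying_in[OF mY mZ n] by (intro Un_least image_subsetI)
  qed
  have "(\<lambda>r. r @ h r) ` SZ =
      (\<lambda>s. underlying g s @ underlying g' s) ` SX \<union> (\<lambda>s. underlying n s @ underlying n' s) ` SY"
    unfolding SZ image_Un image_image using hg hn by simp
  moreover have "(\<lambda>s. underlying g s @ underlying g' s) ` SX \<in> D (z + t)"
    by (rule definable_on_image[OF definable_on_pair[OF HomD_machine(3)[OF mX mZ g] HomD_machine(3)[OF mX mT g']]])
  moreover have "(\<lambda>s. underlying n s @ underlying n' s) ` SY \<in> D (z + t)"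
    by (rule definable_on_image[OF definable_on_pair[OF HomD_machine(3)[OF mY mZ n] HomD_machine(3)[OF mY mT n']]])
  ultimately have graph: "(\<lambda>r. r @ h r) ` SZ \<in> D (z + t)"
    using machineD(1)[OF mZ] by (simp add: D_Un)
  have h_in: "h \<in> SZ \<rightarrow> ST"
    using hg hn underlying_in[OF mX mT g'] underlying_in[OF mY mT n'] unfolding SZ by auto
  have "definable_on z t SZ h"
    unfolding definable_on_def using graph h_in machineD(1,2)[OF mZ] machineD(1,2)[OF mT] D_length
    by (auto simp: Pi_iff)
  moreover have "machine_map I J SZ aZ aT h"
    unfolding machine_map_def
  proof (intro ballI impI)
    fix r u r' v assume r: "r \<in> SZ" and u: "u \<in> I" and r': "r' \<in> SZ" and v: "v \<in> J"
      and step: "aZ (r @ u) = r' @ v"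
    have main: "aT (h r @ u) = h r' @ v"
      if mS: "machine k S b" and e: "e \<in> Hom Sys (mealy I J S b) (mealy I J SZ aZ)"
        and e': "e' \<in> Hom Sys (mealy I J S b) (mealy I J ST aT)"
        and he: "\<And>s. s \<in> S \<Longrightarrow> h (underlying e s) = underlying e' s"
        and s: "s \<in> S" "r = underlying e s" for k S b e e' s
    proof -
      obtain s' w where s': "s' \<in> S" and w: "w \<in> J" and stepS: "b (s @ u) = s' @ w"
        by (rule machine_step[OF mS s(1) u])
      have "underlying e s' @ w = r' @ v"
        using Hom_step[OF mS mZ e s(1) u s' w stepS] step s(2) by simp
      then have eq: "underlying e s' = r' \<and> w = v"
        by (rule split_unique[OF machineD(1,2)[OF mZ] underlying_in[OF mS mZ e s'] r'])
      have "aT (underlying e' s @ u) = underlying e' s' @ w"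
        by (rule Hom_step[OF mS mT e' s(1) u s' w stepS])
      then show ?thesis using eq he[OF s(1)] he[OF s'] s(2) by simp
    qed
    consider s where "s \<in> SX" "r = underlying g s" | s where "s \<in> SY" "r = underlying n s"
      using r unfolding SZ by blast
    then show "aT (h r @ u) = h r' @ v"
    proof cases
      case 1
      show ?thesis by (rule main[OF mX g g' hg 1])
    next
      case 2
      show ?thesis by (rule main[OF mY n n' hn 2])
    qed
  qed
  ultimately show ?thesis
    using HomI_machine[OF mZ mT _ h_in] by (simp add: Z T) (simp add: mealy_def)
qed

text \<open>The two components of the step of a machine \<open>a\<close> with \<open>n\<close>-dimensional states, transported along \<open>\<iota>\<close>: the
  first \<open>k\<close> coordinates of \<open>z\<close> encode, by means of \<open>\<iota>\<close>, a state of \<open>a\<close>, and the remaining ones are the input.\<close>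

definition next_state :: "nat \<Rightarrow> nat \<Rightarrow> (real list \<Rightarrow> real list) \<Rightarrow> (real list \<Rightarrow> real list) \<Rightarrow> real list \<Rightarrow> real list" where
  "next_state k n a \<iota> z = take n (a (\<iota> (take k z) @ drop k z))"

definition emitted :: "nat \<Rightarrow> nat \<Rightarrow> (real list \<Rightarrow> real list) \<Rightarrow> (real list \<Rightarrow> real list) \<Rightarrow> real list \<Rightarrow> real list" where
  "emitted k n a \<iota> z = drop n (a (\<iota> (take k z) @ drop k z))"

lemma next_state_emitted:
  assumes "length e = k" "length t = n" "a (\<iota> e @ u) = t @ v"
  shows "next_state k n a \<iota> (e @ u) = t" "emitted k n a \<iota> (e @ u) = v"
  using assms by (auto simp: next_state_def emitted_def)

lemma definable_next_state_emitted:
  assumes S: "machine n S a" and \<iota>: "definable_on k n E \<iota>" "\<iota> \<in> E \<rightarrow> S"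
  shows "definable_on (k + i) n (cprod E I) (next_state k n a \<iota>)"
    and "definable_on (k + i) j (cprod E I) (emitted k n a \<iota>)"
proof -
  note de = definable_onD[OF \<iota>(1)] and mS = machineD[OF S]
  have EI: "cprod E I \<in> D (k + i)" using de i I by (intro product)
  have SJ: "cprod S J \<in> D (n + j)" using mS j J by (intro product)
  have split: "take k z \<in> E" "drop k z \<in> I" if "z \<in> cprod E I" for z
    using that de(5) by (auto elim!: cprodE)
  have "definable_on (k + i) n (cprod E I) (\<lambda>z. \<iota> (take k z))"
    using split(1) by (intro definable_on_comp[OF definable_on_take[OF de(1) i EI] \<iota>(1)]) blast
  then have "definable_on (k + i) (n + i) (cprod E I) (\<lambda>z. \<iota> (take k z) @ drop k z)"
    by (rule definable_on_pair[OF _ definable_on_drop[OF de(1) i EI]])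
  then have step: "definable_on (k + i) (n + j) (cprod E I) (\<lambda>z. a (\<iota> (take k z) @ drop k z))"
    by (rule definable_on_comp[OF _ mS(4)]) (use split \<iota>(2) in \<open>auto intro!: cprodI\<close>)
  have into: "(\<lambda>z. a (\<iota> (take k z) @ drop k z)) \<in> cprod E I \<rightarrow> cprod S J"
    using split \<iota>(2) mS(3) by (auto intro!: cprodI PiE_mem[OF mS(3)])
  show "definable_on (k + i) n (cprod E I) (next_state k n a \<iota>)"
    unfolding next_state_def by (rule definable_on_comp[OF step definable_on_take[OF mS(1) j SJ] into])
  show "definable_on (k + i) j (cprod E I) (emitted k n a \<iota>)"
    unfolding emitted_def by (rule definable_on_comp[OF step definable_on_drop[OF mS(1) j SJ] into])
qed

text \<open>The fibre product of the state spaces, both components stepping at once. If \<open>s\<close> and \<open>t\<close> lie over the same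
  state of \<open>Z\<close>, then so do their successors, and both machines emit what \<open>Z\<close> emits; thus the joint step stays
  inside the fibre product, and the output may be taken from either machine.\<close>

lemma pullback_exists_Sys:
  assumes p: "p \<in> Hom Sys X Z" and q: "q \<in> Hom Sys Y Z"
  shows "\<exists>P. \<exists>f \<in> Hom Sys P X. \<exists>g \<in> Hom Sys P Y.
    (\<forall>t \<in> fst P. underlying p (underlying f t) = underlying q (underlying g t)) \<and>
    set_pullback (fst P) (fst X) (fst Y) (underlying f) (underlying g) (underlying p) (underlying q)"
proof -
  obtain z SZ aZ where Z: "Z = mealy I J SZ aZ" and mZ: "machine z SZ aZ"
    using Hom_Obj_Sys[OF p] ObjE by blast
  obtain x SX aX where X: "X = mealy I J SX aX" and mX: "machine x SX aX"
    using Hom_Obj_Sys[OF p] ObjE by blast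
  obtain y SY aY where Y: "Y = mealy I J SY aY" and mY: "machine y SY aY"
    using Hom_Obj_Sys[OF q] ObjE by blast
  note p = p[unfolded X Z] and q = q[unfolded Y Z]
  note dX = machineD[OF mX] and dY = machineD[OF mY] and dZ = machineD[OF mZ]
  have lenX: "length s = x" if "s \<in> SX" for s using D_length[OF dX(1,2) that] .
  define \<pi>1 \<pi>2 :: "real list \<Rightarrow> real list" where "\<pi>1 = take x" and "\<pi>2 = drop x"
  have proj [simp]: "\<pi>1 (s @ t) = s" "\<pi>2 (s @ t) = t" if "s \<in> SX" for s t
    using lenX[OF that] by (auto simp: \<pi>1_def \<pi>2_def)
  have XY: "cprod SX SY \<in> D (x + y)" using dX dY by (intro product)
  have def\<pi>: "definable_on (x + y) x (cprod SX SY) \<pi>1" "definable_on (x + y) y (cprod SX SY) \<pi>2"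
    unfolding \<pi>1_def \<pi>2_def using definable_on_take definable_on_drop dX dY XY by auto
  have in\<pi>: "\<pi>1 \<in> cprod SX SY \<rightarrow> SX" "\<pi>2 \<in> cprod SX SY \<rightarrow> SY" by (auto elim!: cprodE)
  define SP where "SP = {r \<in> cprod SX SY. underlying p (\<pi>1 r) = underlying q (\<pi>2 r)}"
  have SP_iff: "s @ t \<in> SP \<longleftrightarrow> t \<in> SY \<and> underlying p s = underlying q t" if s: "s \<in> SX" for s t
  proof -
    have "s @ t \<in> cprod SX SY \<longleftrightarrow> t \<in> SY"
    proof
      assume "s @ t \<in> cprod SX SY"
      then obtain s' t' where "s' \<in> SX" "t' \<in> SY" "s @ t = s' @ t'" by (rule cprodE)
      then show "t \<in> SY" using split_unique[OF dX(1,2) s] by blast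
    qed (rule cprodI[OF s])
    then show ?thesis using s by (simp add: SP_def)
  qed
  have SP_E: thesis if "r \<in> SP" "\<And>s t. \<lbrakk>r = s @ t; s \<in> SX; t \<in> SY; underlying p s = underlying q t\<rbrakk> \<Longrightarrow> thesis"
    for r thesis
    using that(1) by (auto simp: SP_def elim!: cprodE intro: that(2))
  have SP_sub: "SP \<subseteq> cprod SX SY" by (auto simp: SP_def)
  have SP_D: "SP \<in> D (x + y)"
    unfolding SP_def
    using definable_on_comp[OF def\<pi>(1) HomD_machine(3)[OF mX mZ p] in\<pi>(1)]
      definable_on_comp[OF def\<pi>(2) HomD_machine(3)[OF mY mZ q] in\<pi>(2)]
    by (rule D_equalizer)
  have d\<pi>: "definable_on (x + y) x SP \<pi>1" "definable_on (x + y) y SP \<pi>2"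
    using definable_on_subset[OF def\<pi>(1) SP_sub SP_D] definable_on_subset[OF def\<pi>(2) SP_sub SP_D] .
  have i\<pi>: "\<pi>1 \<in> SP \<rightarrow> SX" "\<pi>2 \<in> SP \<rightarrow> SY" using in\<pi> SP_sub by auto
  define step where "step r = next_state (x + y) x aX \<pi>1 r @ next_state (x + y) y aY \<pi>2 r @
      emitted (x + y) x aX \<pi>1 r" for r
  have step: "\<exists>s' t' v. aX (s @ u) = s' @ v \<and> aY (t @ u) = t' @ v \<and> s' \<in> SX \<and> s' @ t' \<in> SP \<and> v \<in> J \<and>
      step ((s @ t) @ u) = s' @ t' @ v"
    if s: "s \<in> SX" and st: "s @ t \<in> SP" and u: "u \<in> I" for s t u
  proof -
    have t: "t \<in> SY" and pq: "underlying p s = underlying q t" using st SP_iff[OF s] by auto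
    obtain s' v where s': "s' \<in> SX" "v \<in> J" "aX (s @ u) = s' @ v" by (rule machine_step[OF mX s u])
    obtain t' w where t': "t' \<in> SY" "w \<in> J" "aY (t @ u) = t' @ w" by (rule machine_step[OF mY t u])
    have "underlying p s' @ v = underlying q t' @ w"
      using Hom_step[OF mX mZ p s u s'] Hom_step[OF mY mZ q t u t'] pq by simp
    then have eq: "underlying p s' = underlying q t' \<and> v = w"
      by (rule split_unique[OF dZ(1,2) underlying_in[OF mX mZ p s'(1)] underlying_in[OF mY mZ q t'(1)]])
    have len: "length (s @ t) = x + y" "length s' = x" "length t' = y"
      using D_length[OF dX(1,2)] D_length[OF dY(1,2)] s t s' t' by auto
    have "step ((s @ t) @ u) = s' @ t' @ v"
      unfolding step_def
      using next_state_emitted[OF len(1,2), of aX \<pi>1 u v] next_state_emitted[OF len(1,3), of aY \<pi>2 u w] s s' t'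
      by simp
    then show ?thesis using s' t' eq SP_iff[OF s'(1)] by auto
  qed
  define aP where "aP = restrict step (cprod SP I)"
  have mP: "machine (x + y) SP aP"
    unfolding machine_def
  proof (intro conjI)
    show "1 \<le> x + y" using dX by simp
    show "SP \<in> D (x + y)" by (rule SP_D)
    show "aP \<in> cprod SP I \<rightarrow>\<^sub>E cprod SP J"
      unfolding aP_def
    proof (rule restrict_PiE_iff[THEN iffD2], rule ballI)
      fix r assume "r \<in> cprod SP I"
      then obtain e u where e: "e \<in> SP" and u: "u \<in> I" and r: "r = e @ u" by (rule cprodE)
      obtain s t where "e = s @ t" "s \<in> SX" using e by (rule SP_E)
      then obtain s' t' v where "s' @ t' \<in> SP" "v \<in> J" "step r = (s' @ t') @ v"
        using step[of s t u] e u r by auto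
      then show "step r \<in> cprod SP J" by (simp only: cprodI)
    qed
    have "definable_on (x + y + i) (x + (y + j)) (cprod SP I) step"
      unfolding step_def
      by (intro definable_on_pair definable_next_state_emitted[OF mX d\<pi>(1) i\<pi>(1)]
          definable_next_state_emitted[OF mY d\<pi>(2) i\<pi>(2)])
    then have "definable_on (x + y + i) (x + y + j) (cprod SP I) step" by (simp add: add.assoc)
    then show "definable_on (x + y + i) (x + y + j) (cprod SP I) aP"
      by (rule definable_on_cong) (simp add: aP_def)
  qed
  have aP: "\<exists>s1 t1. e' = s1 @ t1 \<and> s1 \<in> SX \<and> aX (s @ u) = s1 @ v \<and> aY (t @ u) = t1 @ v"
    if s: "s \<in> SX" and st: "s @ t \<in> SP" and u: "u \<in> I" and e': "e' \<in> SP"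
      and eq: "aP ((s @ t) @ u) = e' @ v" for s t u e' v
  proof -
    obtain s1 t1 w where st1: "aX (s @ u) = s1 @ w" "aY (t @ u) = t1 @ w" "s1 \<in> SX" "s1 @ t1 \<in> SP"
      "step ((s @ t) @ u) = s1 @ t1 @ w" using step[OF s st u] by blast
    have "aP ((s @ t) @ u) = (s1 @ t1) @ w" using st1(5) cprodI[OF st u] by (simp add: aP_def)
    then have "(s1 @ t1) @ w = e' @ v" using eq by simp
    then have "s1 @ t1 = e' \<and> w = v" by (rule split_unique[OF machineD(1,2)[OF mP] st1(4) e'])
    then show ?thesis using st1 by blast
  qed
  have "machine_map I J SP aP aX \<pi>1"
    unfolding machine_map_def
  proof (intro ballI impI)
    fix e u e' v assume e: "e \<in> SP" "u \<in> I" "e' \<in> SP" "v \<in> J" "aP (e @ u) = e' @ v"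
    obtain s t where st: "e = s @ t" "s \<in> SX" using e(1) by (rule SP_E)
    have "\<exists>s1 t1. e' = s1 @ t1 \<and> s1 \<in> SX \<and> aX (s @ u) = s1 @ v \<and> aY (t @ u) = t1 @ v"
      by (rule aP[OF st(2) _ e(2,3)]) (use e st in simp_all)
    then show "aX (\<pi>1 e @ u) = \<pi>1 e' @ v" using st by auto
  qed
  from HomI_machine[OF mP mX d\<pi>(1) i\<pi>(1) this] obtain f
    where f: "f \<in> Hom Sys (mealy I J SP aP) X" "\<And>e. e \<in> SP \<Longrightarrow> underlying f e = \<pi>1 e" unfolding X by blast
  have "machine_map I J SP aP aY \<pi>2"
    unfolding machine_map_def
  proof (intro ballI impI)
    fix e u e' v assume e: "e \<in> SP" "u \<in> I" "e' \<in> SP" "v \<in> J" "aP (e @ u) = e' @ v"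
    obtain s t where st: "e = s @ t" "s \<in> SX" using e(1) by (rule SP_E)
    have "\<exists>s1 t1. e' = s1 @ t1 \<and> s1 \<in> SX \<and> aX (s @ u) = s1 @ v \<and> aY (t @ u) = t1 @ v"
      by (rule aP[OF st(2) _ e(2,3)]) (use e st in simp_all)
    then show "aY (\<pi>2 e @ u) = \<pi>2 e' @ v" using st by auto
  qed
  from HomI_machine[OF mP mY d\<pi>(2) i\<pi>(2) this] obtain g
    where g: "g \<in> Hom Sys (mealy I J SP aP) Y" "\<And>e. e \<in> SP \<Longrightarrow> underlying g e = \<pi>2 e" unfolding Y by blast
  have comm: "\<forall>e \<in> SP. underlying p (underlying f e) = underlying q (underlying g e)"
    using f(2) g(2) by (simp add: SP_def)
  have "set_pullback SP SX SY (underlying f) (underlying g) (underlying p) (underlying q)"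
    unfolding set_pullback_def
  proof (intro ballI impI)
    fix s t assume s: "s \<in> SX" and t: "t \<in> SY" and pq: "underlying p s = underlying q t"
    have st: "s @ t \<in> SP" using SP_iff[OF s] t pq by simp
    show "\<exists>!e. e \<in> SP \<and> underlying f e = s \<and> underlying g e = t"
    proof (rule ex1I[of _ "s @ t"])
      show "s @ t \<in> SP \<and> underlying f (s @ t) = s \<and> underlying g (s @ t) = t"
        using st s f(2) g(2) by simp
      fix e assume e: "e \<in> SP \<and> underlying f e = s \<and> underlying g e = t"
      then have "\<pi>1 e = s" "\<pi>2 e = t" using f(2) g(2) by auto
      then show "e = s @ t" by (auto simp: \<pi>1_def \<pi>2_def)
    qed
  qed
  then show ?thesis using f(1) g(1) comm
    by (intro exI[of _ "mealy I J SP aP"] bexI[OF _ f(1)] bexI[OF _ g(1)]) (simp add: X Y mealy_def)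
qed

text \<open>The states are those of \<open>Y\<close> together with those of \<open>X\<close> outside the image of \<open>m\<close>; the complement of a definable
  set is definable, so no quotient has to be formed. States of \<open>Y\<close> step as in \<open>Y\<close>. A state of \<open>X\<close> outside the
  image steps as in \<open>X\<close>, and a successor \<open>m w\<close> inside the image is replaced by \<open>f w\<close>. The map \<open>g\<close> out of \<open>X\<close>
  is then a morphism also at the states \<open>m w\<close>, because \<open>m\<close> and \<open>f\<close> are.\<close>

lemma gluing_exists_Sys:
  assumes m: "m \<in> Hom Sys W X" and f: "f \<in> Hom Sys W Y" and inj_m: "inj_on (underlying m) (fst W)"
  shows "\<exists>Z. \<exists>g \<in> Hom Sys X Z. \<exists>n \<in> Hom Sys Y Z.
    (\<forall>t \<in> fst W. underlying g (underlying m t) = underlying n (underlying f t)) \<and>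
    set_gluing (fst W) (fst X) (fst Y) (fst Z) (underlying m) (underlying g) (underlying n)"
proof -
  obtain w SW aW where W: "W = mealy I J SW aW" and mW: "machine w SW aW"
    using Hom_Obj_Sys[OF m] ObjE by blast
  obtain x SX aX where X: "X = mealy I J SX aX" and mX: "machine x SX aX"
    using Hom_Obj_Sys[OF m] ObjE by blast
  obtain y SY aY where Y: "Y = mealy I J SY aY" and mY: "machine y SY aY"
    using Hom_Obj_Sys[OF f] ObjE by blast
  note m = m[unfolded W X] and f = f[unfolded W Y]
  have inj_m: "inj_on (underlying m) SW" using inj_m by (simp add: W mealy_def)
  note dX = machineD[OF mX] and dY = machineD[OF mY] and dW = machineD[OF mW]
  note hm = HomD_machine[OF mW mX m] and hf = HomD_machine[OF mW mY f]
  let ?mW = "underlying m ` SW"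
  define SC where "SC = SX - ?mW"
  have mW_D: "?mW \<in> D x" by (rule definable_on_image[OF hm(3)])
  have mW_sub: "?mW \<subseteq> SX" using underlying_in[OF mW mX m] by blast
  have SC_D: "SC \<in> D x" unfolding SC_def by (rule D_Diff[OF dX(1,2) mW_D])
  have SX_split: "SX = SC \<union> ?mW" using mW_sub by (auto simp: SC_def)
  let ?k = "1 + (x + y)"
  \<comment> \<open>A disjoint union in one space: a leading tag, one block of coordinates for each summand,
    and zeros in the block of the other summand.\<close>
  define \<iota>X :: "real list \<Rightarrow> real list" where "\<iota>X s = [1] @ s @ replicate y 0" for s
  define \<iota>Y :: "real list \<Rightarrow> real list" where "\<iota>Y t = [0] @ replicate x 0 @ t" for t
  have inj: "inj_on \<iota>X A" "inj_on \<iota>Y A" for A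
    by (auto simp: inj_on_def \<iota>X_def \<iota>Y_def)
  have d\<iota>X: "definable_on x ?k A \<iota>X" if "A \<in> D x" for A
  proof -
    have "definable_on x (length (replicate y (0::real))) A (\<lambda>_. replicate y 0)"
      using dX dY that by (intro definable_on_const) auto
    then have "definable_on x y A (\<lambda>_. replicate y 0)" by simp
    moreover have "definable_on x (length [1::real]) A (\<lambda>_. [1])"
      using dX that by (intro definable_on_const) auto
    then have "definable_on x 1 A (\<lambda>_. [1])" by simp
    ultimately show ?thesis unfolding \<iota>X_def
      by (intro definable_on_pair definable_on_id dX(1) that)
  qed
  have d\<iota>Y: "definable_on y ?k A \<iota>Y" if "A \<in> D y" for A
  proof -
    have "definable_on y (length (replicate x (0::real))) A (\<lambda>_. replicate x 0)"
      using dX dY that by (intro definable_on_const) auto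
    then have "definable_on y x A (\<lambda>_. replicate x 0)" by simp
    moreover have "definable_on y (length [0::real]) A (\<lambda>_. [0])"
      using dY that by (intro definable_on_const) auto
    then have "definable_on y 1 A (\<lambda>_. [0])" by simp
    ultimately show ?thesis unfolding \<iota>Y_def
      by (intro definable_on_pair definable_on_id dY(1) that)
  qed
  define KX KY SZ where "KX = \<iota>X ` SC" and "KY = \<iota>Y ` SY" and "SZ = KX \<union> KY"
  have apart: "KX \<inter> KY = {}" by (auto simp: KX_def KY_def \<iota>X_def \<iota>Y_def)
  have k: "1 \<le> ?k" by simp
  have KX_D: "KX \<in> D ?k" unfolding KX_def by (rule definable_on_image[OF d\<iota>X[OF SC_D]])
  have KY_D: "KY \<in> D ?k" unfolding KY_def by (rule definable_on_image[OF d\<iota>Y[OF dY(2)]])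
  have SZ_D: "SZ \<in> D ?k" unfolding SZ_def by (rule D_Un[OF k KX_D KY_D])
  have \<iota>Y_in: "\<iota>Y t \<in> SZ" if "t \<in> SY" for t using that by (simp add: SZ_def KY_def)
  \<comment> \<open>The states of X outside the image of m are kept; m w has to go where f w goes, and w is recovered from
    m w as m is injective on states.\<close>
  define \<gamma> where "\<gamma> s = (if s \<in> SC then \<iota>X s else \<iota>Y (underlying f (inv_into SW (underlying m) s)))" for s
  have \<gamma>_C: "\<gamma> s = \<iota>X s" if "s \<in> SC" for s using that by (simp add: \<gamma>_def)
  have \<gamma>_m: "\<gamma> (underlying m s) = \<iota>Y (underlying f s)" if "s \<in> SW" for s
    using that inj_m by (simp add: \<gamma>_def SC_def)
  have \<gamma>_in: "\<gamma> s \<in> SZ" if sX: "s \<in> SX" for s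
  proof (cases "s \<in> SC")
    case True
    then show ?thesis by (simp add: \<gamma>_C SZ_def KX_def)
  next
    case False
    then obtain s' where "s' \<in> SW" "s = underlying m s'" using sX SX_split by blast
    then show ?thesis using \<gamma>_m \<iota>Y_in underlying_in[OF mW mY f] by simp
  qed
  have "definable_on x ?k SC \<gamma>"
    by (rule definable_on_cong[OF d\<iota>X[OF SC_D]]) (simp add: \<gamma>_C)
  moreover have "definable_on x ?k ?mW \<gamma>"
  proof -
    have "definable_on w ?k SW (\<lambda>s. \<iota>Y (underlying f s))"
      by (rule definable_on_comp[OF hf(3) d\<iota>Y[OF dY(2)]]) (use underlying_in[OF mW mY f] in blast)
    then have "definable_on x ?k ?mW (\<lambda>s. \<iota>Y (underlying f (inv_into SW (underlying m) s)))"
      by (rule definable_on_comp[OF definable_on_inverse[OF hm(3) inj_m]]) (auto simp: inj_m)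
    then show ?thesis by (rule definable_on_cong) (simp add: \<gamma>_def SC_def)
  qed
  ultimately have d\<gamma>: "definable_on x ?k SX \<gamma>"
    by (subst SX_split) (rule definable_on_Un)
  \<comment> \<open>The decodings of the two summands, used to run the steps of X and Y on tagged states.\<close>
  define \<rho>X \<rho>Y where "\<rho>X = inv_into SC \<iota>X" and "\<rho>Y = inv_into SY \<iota>Y"
  have \<rho>: "\<rho>X (\<iota>X s) = s" if "s \<in> SC" for s using inv_into_f_f[OF inj(1) that] by (simp add: \<rho>X_def)
  have \<rho>': "\<rho>Y (\<iota>Y t) = t" if "t \<in> SY" for t using inv_into_f_f[OF inj(2) that] by (simp add: \<rho>Y_def)
  have d\<rho>X: "definable_on ?k x KX \<rho>X" unfolding KX_def \<rho>X_def
    by (rule definable_on_inverse[OF d\<iota>X[OF SC_D] inj(1)])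
  have d\<rho>Y: "definable_on ?k y KY \<rho>Y" unfolding KY_def \<rho>Y_def
    by (rule definable_on_inverse[OF d\<iota>Y[OF dY(2)] inj(2)])
  have i\<rho>: "\<rho>X \<in> KX \<rightarrow> SX" "\<rho>Y \<in> KY \<rightarrow> SY"
    by (auto simp: KX_def KY_def \<rho> \<rho>' SX_split)
  have len: "length (\<iota>X s) = ?k" if "s \<in> SX" for s using D_length[OF dX(1,2) that] by (simp add: \<iota>X_def)
  have len': "length (\<iota>Y t) = ?k" if "t \<in> SY" for t using D_length[OF dY(1,2) that] by (simp add: \<iota>Y_def)
  define stepX where "stepX r = \<gamma> (next_state ?k x aX \<rho>X r) @ emitted ?k x aX \<rho>X r" for r
  define stepY where "stepY r = \<iota>Y (next_state ?k y aY \<rho>Y r) @ emitted ?k y aY \<rho>Y r" for r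
  have stepX: "stepX (\<iota>X s @ u) = \<gamma> s' @ v" if s: "s \<in> SC" and s': "s' \<in> SX" and step: "aX (s @ u) = s' @ v"
    for s u s' v
  proof -
    have sX: "s \<in> SX" using s by (simp add: SC_def)
    have "aX (\<rho>X (\<iota>X s) @ u) = s' @ v" using step \<rho>[OF s] by simp
    from next_state_emitted[where a = aX and \<iota> = \<rho>X, OF len[OF sX] D_length[OF dX(1,2) s'] this] show ?thesis
      by (simp add: stepX_def)
  qed
  have stepY: "stepY (\<iota>Y t @ u) = \<iota>Y t' @ v" if t: "t \<in> SY" and t': "t' \<in> SY" and step: "aY (t @ u) = t' @ v"
    for t u t' v
  proof -
    have "aY (\<rho>Y (\<iota>Y t) @ u) = t' @ v" using step \<rho>'[OF t] by simp
    from next_state_emitted[where a = aY and \<iota> = \<rho>Y, OF len'[OF t] D_length[OF dY(1,2) t'] this] show ?thesis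
      by (simp add: stepY_def)
  qed
  define aZ where "aZ = (\<lambda>r \<in> cprod SZ I. if take ?k r \<in> KX then stepX r else stepY r)"
  have aZ_X: "aZ (\<iota>X s @ u) = \<gamma> s' @ v"
    if s: "s \<in> SC" and u: "u \<in> I" and s': "s' \<in> SX" and step: "aX (s @ u) = s' @ v" for s u s' v
  proof -
    have sX: "s \<in> SX" and sE: "\<iota>X s \<in> KX" using s by (auto simp: SC_def KX_def)
    have "take ?k (\<iota>X s @ u) = \<iota>X s" using len[OF sX] by simp
    moreover have "\<iota>X s @ u \<in> cprod SZ I" using sE u by (intro cprodI) (auto simp: SZ_def)
    ultimately show ?thesis using stepX[OF s s' step] sE by (simp add: aZ_def)
  qed
  have aZ_Y: "aZ (\<iota>Y t @ u) = \<iota>Y t' @ v"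
    if t: "t \<in> SY" and u: "u \<in> I" and t': "t' \<in> SY" and step: "aY (t @ u) = t' @ v" for t u t' v
  proof -
    have "take ?k (\<iota>Y t @ u) = \<iota>Y t" using len'[OF t] by simp
    moreover have "\<iota>Y t \<notin> KX" using apart t by (auto simp: KY_def)
    moreover have "\<iota>Y t @ u \<in> cprod SZ I" using \<iota>Y_in[OF t] u by (intro cprodI)
    ultimately show ?thesis using stepY[OF t t' step] by (simp add: aZ_def)
  qed
  have take_in: "take ?k r \<in> E" if "E \<in> D ?k" "r \<in> cprod E I" for E r
    using that D_length[OF k] by (auto elim!: cprodE)
  have mZ: "machine ?k SZ aZ"
    unfolding machine_def
  proof (intro conjI)
    show "1 \<le> ?k" "SZ \<in> D ?k" by (fact k SZ_D)+
    have "aZ r \<in> cprod SZ J" if r_in: "r \<in> cprod SZ I" for r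
    proof -
      obtain e u where e: "e \<in> SZ" and u: "u \<in> I" and r: "r = e @ u" using r_in by (rule cprodE)
      consider s where "s \<in> SC" "e = \<iota>X s" | t where "t \<in> SY" "e = \<iota>Y t"
        using e unfolding SZ_def KX_def KY_def by blast
      then show ?thesis
      proof cases
        case 1
        then have "s \<in> SX" by (simp add: SC_def)
        then obtain s' v where "s' \<in> SX" "v \<in> J" "aX (s @ u) = s' @ v" by (rule machine_step[OF mX _ u])
        then show ?thesis using aZ_X[OF 1(1) u] 1 r \<gamma>_in by (simp add: cprodI)
      next
        case 2
        obtain t' v where "t' \<in> SY" "v \<in> J" "aY (t @ u) = t' @ v" by (rule machine_step[OF mY 2(1) u])
        then show ?thesis using aZ_Y[OF 2(1) u] 2 r \<iota>Y_in by (simp add: cprodI)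
      qed
    qed
    moreover have "aZ \<in> extensional (cprod SZ I)" by (simp add: aZ_def)
    ultimately show "aZ \<in> cprod SZ I \<rightarrow>\<^sub>E cprod SZ J" by (simp add: PiE_def)
    have nX: "next_state ?k x aX \<rho>X \<in> cprod KX I \<rightarrow> SX"
    proof
      fix r assume "r \<in> cprod KX I"
      then obtain e u where e: "e \<in> KX" and u: "u \<in> I" and r: "r = e @ u" by (rule cprodE)
      have "\<rho>X e \<in> SX" using i\<rho>(1) e by blast
      then obtain s' v where s': "s' \<in> SX" "v \<in> J" "aX (\<rho>X e @ u) = s' @ v" by (rule machine_step[OF mX _ u])
      show "next_state ?k x aX \<rho>X r \<in> SX"
        using next_state_emitted(1)[where a = aX and \<iota> = \<rho>X, OF D_length[OF k KX_D e] D_length[OF dX(1,2) s'(1)] s'(3)] s'(1) r by simp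
    qed
    have nY: "next_state ?k y aY \<rho>Y \<in> cprod KY I \<rightarrow> SY"
    proof
      fix r assume "r \<in> cprod KY I"
      then obtain e u where e: "e \<in> KY" and u: "u \<in> I" and r: "r = e @ u" by (rule cprodE)
      have "\<rho>Y e \<in> SY" using i\<rho>(2) e by blast
      then obtain s' v where s': "s' \<in> SY" "v \<in> J" "aY (\<rho>Y e @ u) = s' @ v" by (rule machine_step[OF mY _ u])
      show "next_state ?k y aY \<rho>Y r \<in> SY"
        using next_state_emitted(1)[where a = aY and \<iota> = \<rho>Y, OF D_length[OF k KY_D e] D_length[OF dY(1,2) s'(1)] s'(3)] s'(1) r by simp
    qed
    note stX = definable_next_state_emitted[OF mX d\<rho>X i\<rho>(1)] and stY = definable_next_state_emitted[OF mY d\<rho>Y i\<rho>(2)]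
    have "definable_on (?k + i) (?k + j) (cprod KX I) stepX"
      unfolding stepX_def by (rule definable_on_pair[OF definable_on_comp[OF stX(1) d\<gamma> nX] stX(2)])
    then have "definable_on (?k + i) (?k + j) (cprod KX I) aZ"
    proof (rule definable_on_cong)
      fix r assume r: "r \<in> cprod KX I"
      then have "r \<in> cprod SZ I" by (auto simp: cprod_iff SZ_def)
      then show "stepX r = aZ r" using take_in[OF KX_D r] by (simp add: aZ_def)
    qed
    moreover have "definable_on (?k + i) (?k + j) (cprod KY I) stepY"
      unfolding stepY_def by (rule definable_on_pair[OF definable_on_comp[OF stY(1) d\<iota>Y[OF dY(2)] nY] stY(2)])
    then have "definable_on (?k + i) (?k + j) (cprod KY I) aZ"
    proof (rule definable_on_cong)
      fix r assume r: "r \<in> cprod KY I"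
      then have "r \<in> cprod SZ I" by (auto simp: cprod_iff SZ_def)
      moreover have "take ?k r \<notin> KX" using take_in[OF KY_D r] apart by blast
      ultimately show "stepY r = aZ r" by (simp add: aZ_def)
    qed
    ultimately have "definable_on (?k + i) (?k + j) (cprod KX I \<union> cprod KY I) aZ" by (rule definable_on_Un)
    moreover have "cprod KX I \<union> cprod KY I = cprod SZ I" by (auto simp: cprod_def SZ_def)
    ultimately show "definable_on (?k + i) (?k + j) (cprod SZ I) aZ" by simp
  qed
  have "machine_map I J SX aX aZ \<gamma>"
    unfolding machine_map_def
  proof (intro ballI impI)
    fix s u s' v assume s: "s \<in> SX" and u: "u \<in> I" and s': "s' \<in> SX" and v: "v \<in> J" and step: "aX (s @ u) = s' @ v"
    show "aZ (\<gamma> s @ u) = \<gamma> s' @ v"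
    \<comment> \<open>For s = m r the steps of s in X and of f r in Y are both images of the step of r in W.\<close>
    proof (cases "s \<in> SC")
      case True
      then show ?thesis using aZ_X[OF True u s' step] \<gamma>_C by simp
    next
      case False
      then obtain r where r: "r \<in> SW" "s = underlying m r" using s SX_split by blast
      obtain r' v' where r': "r' \<in> SW" "v' \<in> J" "aW (r @ u) = r' @ v'" by (rule machine_step[OF mW r(1) u])
      have "underlying m r' @ v' = s' @ v" using Hom_step[OF mW mX m r(1) u r'] step r(2) by simp
      then have eq: "underlying m r' = s' \<and> v' = v"
        by (rule split_unique[OF dX(1,2) underlying_in[OF mW mX m r'(1)] s'])
      have "aY (underlying f r @ u) = underlying f r' @ v'" by (rule Hom_step[OF mW mY f r(1) u r'])
      then have "aZ (\<iota>Y (underlying f r) @ u) = \<iota>Y (underlying f r') @ v'"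
        by (rule aZ_Y[OF underlying_in[OF mW mY f r(1)] u underlying_in[OF mW mY f r'(1)]])
      then show ?thesis using \<gamma>_m[OF r(1)] \<gamma>_m[OF r'(1)] r(2) eq by simp
    qed
  qed
  moreover have "\<gamma> \<in> SX \<rightarrow> SZ" using \<gamma>_in by blast
  ultimately obtain g where g: "g \<in> Hom Sys X (mealy I J SZ aZ)" "\<forall>s \<in> SX. underlying g s = \<gamma> s"
    using HomI_machine[OF mX mZ d\<gamma>] unfolding X by blast
  have "machine_map I J SY aY aZ \<iota>Y"
    unfolding machine_map_def using aZ_Y by simp
  moreover have "\<iota>Y \<in> SY \<rightarrow> SZ" using \<iota>Y_in by blast
  ultimately obtain n where n: "n \<in> Hom Sys Y (mealy I J SZ aZ)" "\<forall>t \<in> SY. underlying n t = \<iota>Y t"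
    using HomI_machine[OF mY mZ d\<iota>Y[OF dY(2)]] unfolding Y by blast
  have comm: "\<forall>t \<in> SW. underlying g (underlying m t) = underlying n (underlying f t)"
    using g(2) n(2) \<gamma>_m underlying_in[OF mW mX m] underlying_in[OF mW mY f] by simp
  have gC: "underlying g s = \<iota>X s" if "s \<in> SC" for s using that g(2) \<gamma>_C[OF that] by (simp add: SC_def)
  have gimg: "underlying g ` SC = KX" unfolding KX_def by (rule image_cong[OF refl gC])
  have nimg: "underlying n ` SY = KY" unfolding KY_def using n(2) by (intro image_cong) auto
  have "set_gluing SW SX SY SZ (underlying m) (underlying g) (underlying n)"
    unfolding set_gluing_def SC_def[symmetric] gimg nimg
  proof (intro conjI)
    show "inj_on (underlying n) SY" using inj_on_cong[of SY "underlying n" \<iota>Y] n(2) inj(2) by simp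
    show "inj_on (underlying g) SC" using inj_on_cong[of SC "underlying g" \<iota>X] gC inj(1) by simp
    show "KX \<inter> KY = {}" by (rule apart)
    show "SZ \<subseteq> KX \<union> KY" by (simp add: SZ_def)
  qed
  then show ?thesis using comm
    by (intro exI[of _ "mealy I J SZ aZ"] bexI[OF _ g(1)] bexI[OF _ n(1)]) (simp add: W X Y mealy_def)
qed

theorem adhesive_Sys: "adhesive Sys"
proof -
  interpret category Sys by (rule category_Sys)
  interpret set_like_category Sys fst underlying
  proof
    show "underlying f \<in> fst A \<rightarrow> fst B" if "f \<in> Hom Sys A B" for f A B
      by (rule underlying_funcset[OF that])
    show "underlying (g \<cdot>\<^bsub>Sys\<^esub> f) x = underlying g (underlying f x)"
      if "f \<in> Hom Sys A B" "g \<in> Hom Sys B E" "x \<in> fst A" for f g A B E x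
      by (rule underlying_Cmp[OF that])
    show "underlying (Ide Sys A) x = x" if "A \<in> Obj Sys" "x \<in> fst A" for A x
      by (rule underlying_Ide[OF that])
    show "f = g" if "f \<in> Hom Sys A B" "g \<in> Hom Sys A B" "\<And>x. x \<in> fst A \<Longrightarrow> underlying f x = underlying g x"
      for f g A B
      by (rule underlying_faithful[OF that])
  qed (fact cone_lift_Sys cocone_lift_Sys pullback_exists_Sys gluing_exists_Sys)+
  show ?thesis by (rule adhesive)
qed

end

theorem theorem2p8:
  fixes D :: "nat \<Rightarrow> real list set set" and I J :: "real list set"
  assumes "o_minimal D"
    and "I \<in> Obj (DefCat D)" and "J \<in> Obj (DefCat D)"
    and "I \<noteq> {}" and "J \<noteq> {}"
  shows "adhesive (SysHo (DefCat D) I J)"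
proof -
  obtain i j where "1 \<le> i" "I \<in> D i" "1 \<le> j" "J \<in> D j"
    using assms(2,3) by (auto simp: DefCat_def definable_def)
  then interpret definable_interface D I J i j
    using assms(1) by (intro definable_interface.intro definable_interface_axioms.intro)
  show ?thesis by (rule adhesive_Sys)
qed

end
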